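(* Let $X_k$ ($k\in\mathbb{Z}$) be the cluster variables of the generalized quantum cluster algebra of Kronecker type $\mathcal{A}_q(2,2)$, let $X_\delta=q^{\frac12}X_0X_3-q^{\frac12}(q^{\frac12}X_1+h)(q^{\frac12}X_2+h)\in\mathcal{A}_q(2,2)$, and let $F_n(x)$ be the Chebyshev polynomials of the first kind. Then the set $$\mathcal{B}=\{q^{-\frac{a_1a_2}{2}}X_m^{a_1}X_{m+1}^{a_2}\mid m\in\mathbb{Z},\ (a_1,a_2)\in\mathbb{Z}_{\geq0}^2\}\sqcup\{F_n(X_\delta)\mid n\in\mathbb{Z}_{>0}\}$$ is a positive bar-invariant $\mathbb{Z}[q^{\pm\frac12},h]$-basis of $\mathcal{A}_q(2,2)$. That is: $\mathcal{B}$ is a basis of $\mathcal{A}_q(2,2)$ over $\mathbb{Z}[q^{\pm\frac12},h]$, every element of $\mathcal{B}$ is bar-invariant, and the product of any two elements of $\mathcal{B}$ is a linear combination of elements of $\mathcal{B}$ with coefficients in $\mathbb{Z}_{\geq0}[q^{\pm\frac12},h]$.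
   Context: Let $q$ be a formal variable, and fix $h\in\mathbb{Z}[q^{\pm\frac12}]$ with $\overline{h}=h$, where the bar on $\mathbb{Z}[q^{\pm\frac12}]$ is the ring involution $q^{\frac12}\mapsto q^{-\frac12}$. Quantum torus: $\mathcal{T}$ is the $\mathbb{Z}[q^{\pm\frac12}]$-algebra with free $\mathbb{Z}[q^{\pm\frac12}]$-basis $\{X(\mathbf a)\mid \mathbf a\in\mathbb{Z}^2\}$ and multiplication $X(\mathbf a)X(\mathbf b)=q^{\frac12\Lambda(\mathbf a,\mathbf b)}X(\mathbf a+\mathbf b)$, where $\Lambda(\mathbf a,\mathbf b)=a_1b_2-a_2b_1$ (elements of $\mathbb{Z}[q^{\pm\frac12}]$ are central). Put $X_1=X(1,0)$, $X_2=X(0,1)$; thus $X_1X_2=qX_2X_1$. Let $\mathcal{F}$ be the skew-field of fractions of $\mathcal{T}$. The bar-involution on $\mathcal{T}$ is the $\mathbb{Z}$-linear map with $\overline{q^{\frac r2}X(\mathbf a)}=q^{-\frac r2}X(\mathbf a)$ for $r\in\mathbb{Z}$, $\mathbf a\in\mathbb{Z}^2$; an element is bar-invariant if it is fixed by this map. Cluster variables: the elements $X_k\in\mathcal{F}$ ($k\in\mathbb{Z}$) are determined from $X_1,X_2$ by the exchange relations $X_{k-1}X_{k+1}=qX_k^2+q^{\frac12}hX_k+1$ for all $k\in\mathbb{Z}$; by the (known) Laurent phenomenon all $X_k$ lie in $\mathcal{T}$. The algebra $\mathcal{A}_q(2,2)$ is the $\mathbb{Z}[q^{\pm\frac12}]$-subalgebra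 of $\mathcal{T}$ generated by all $X_k$, $k\in\mathbb{Z}$. (It is the generalized quantum cluster algebra with initial data $\mathbf d=(2,2)$, exchange coefficients $\mathbf h_1=\mathbf h_2=(1,h,1)$, $\Lambda=\begin{pmatrix}0&1\\-1&0\end{pmatrix}$, $B=\begin{pmatrix}0&2\\-2&0\end{pmatrix}$.) Chebyshev polynomials: $F_0(x)=1$, $F_1(x)=x$, $F_2(x)=x^2-2$, $F_{n+1}(x)=F_n(x)x-F_{n-1}(x)$ for $n\geq2$. Since $h\in\mathbb{Z}[q^{\pm\frac12}]$, the ring $\mathbb{Z}[q^{\pm\frac12},h]$ is just $\mathbb{Z}[q^{\pm\frac12}]$. The symbol $\mathbb{Z}_{\geq0}[q^{\pm\frac12},h]$ denotes the set of elements that can be written as polynomials in $q^{\frac12},q^{-\frac12},h$ with non-negative integer coefficients. A basis of $\mathcal{A}_q(2,2)$ is called a positive $\mathbb{Z}[q^{\pm\frac12},h]$-basis if its structure constants belong to $\mathbb{Z}_{\geq0}[q^{\pm\frac12},h]$. $\mathcal{B}$ is regarded as a set (so repeated descriptions of the same element, e.g. $X_m^{0}X_{m+1}^{a}$ and $X_{m+1}^{a}X_{m+2}^{0}$, count once). *)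

theory Defs
  imports
    Complex_Main
    "HOL-Library.Poly_Mapping"
    "HOL-Library.Product_Plus"
begin

text \<open>
  The Laurent polynomial ring $\mathbb{Z}[q^{\pm 1/2}]$ is the group ring of the integers: finitely
  supported functions with the convolution product of \<^theory>\<open>HOL-Library.Poly_Mapping\<close>.  The
  integer $r$ in the support stands for the power $q^{r/2}$.
\<close>

type_synonym laurent = "int \<Rightarrow>\<^sub>0 int"

definition qh :: "int \<Rightarrow> laurent" where \<comment> \<open>$q^{r/2}$\<close>
  "qh r = Poly_Mapping.single r 1"

lemma qh_0 [simp]: "qh 0 = 1"
  by (simp add: qh_def)

lemma qh_add: "qh (r + s) = qh r * qh s"
  by (simp add: qh_def mult_single)

definition bar :: "laurent \<Rightarrow> laurent" where
  "bar p = Poly_Mapping.map_key uminus p"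

lemma lookup_bar: "Poly_Mapping.lookup (bar p) r = Poly_Mapping.lookup p (- r)"
  by (simp add: bar_def map_key.rep_eq)

lemma bar_0 [simp]: "bar 0 = 0"
  by (rule poly_mapping_eqI) (simp add: lookup_bar)

lemma bar_add: "bar (p + p') = bar p + bar p'"
  by (rule poly_mapping_eqI) (simp add: lookup_bar lookup_add)

lemma bar_qh [simp]: "bar (qh r) = qh (- r)"
  by (rule poly_mapping_eqI) (auto simp: lookup_bar qh_def lookup_single when_def)

lemma poly_mapping_add_induct [case_names zero monom add]:
  fixes p :: "'a \<Rightarrow>\<^sub>0 'b::comm_monoid_add"
  assumes "P 0" and "\<And>a c. P (Poly_Mapping.single a c)" and "\<And>x y. P x \<Longrightarrow> P y \<Longrightarrow> P (x + y)"
  shows "P p"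
proof (induction p rule: update_induct)
  case const
  then show ?case by (simp add: assms(1))
next
  case (update f a b)
  have "Poly_Mapping.update a b f = f + Poly_Mapping.single a b"
    using update.hyps
    by (intro poly_mapping_eqI)
      (auto simp: lookup_update lookup_add lookup_single when_def in_keys_iff)
  then show ?case
    using assms update.IH by simp
qed

lemma bar_mult: "bar (p * p') = bar p * bar p'"
proof (induction p rule: poly_mapping_add_induct)
  case (monom a c)
  show ?case
  proof (induction p' rule: poly_mapping_add_induct)
    case (monom b d)
    have "bar (Poly_Mapping.single r k) = Poly_Mapping.single (- r) k" for r and k :: int
      by (rule poly_mapping_eqI) (auto simp: lookup_bar lookup_single when_def)
    then show ?case by (simp add: mult_single)
  qed (simp_all add: bar_add algebra_simps)
qed (simp_all add: bar_add algebra_simps)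

lemma bar_bar [simp]: "bar (bar p) = p"
  by (rule poly_mapping_eqI) (simp add: lookup_bar)

lemma bar_1 [simp]: "bar 1 = 1"
  using bar_qh[of 0] by simp

definition Lam :: "int \<times> int \<Rightarrow> int \<times> int \<Rightarrow> int" where
  "Lam a b = fst a * snd b - snd a * fst b"

lemma Lam_add: "Lam (a + b) c = Lam a c + Lam b c" "Lam a (b + c) = Lam a b + Lam a c"
  by (simp_all add: Lam_def algebra_simps)

lemma Lam_0 [simp]: "Lam 0 a = 0" "Lam a 0 = 0"
  by (simp_all add: Lam_def)

text \<open>
  A separate copy of the finitely supported functions, because their own product is the untwisted
  convolution.
\<close>

typedef qtorus = "UNIV :: ((int \<times> int) \<Rightarrow>\<^sub>0 laurent) set"
  morphisms coeffs Qtorus ..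

setup_lifting type_definition_qtorus

definition tmul ::
  "((int \<times> int) \<Rightarrow>\<^sub>0 laurent) \<Rightarrow> ((int \<times> int) \<Rightarrow>\<^sub>0 laurent) \<Rightarrow> ((int \<times> int) \<Rightarrow>\<^sub>0 laurent)" where
  "tmul x y = (\<Sum>a\<in>Poly_Mapping.keys x. \<Sum>b\<in>Poly_Mapping.keys y.
     Poly_Mapping.single (a + b)
       (Poly_Mapping.lookup x a * Poly_Mapping.lookup y b * qh (Lam a b)))"

lemma tmul_superset:
  assumes "finite A" "finite B" "Poly_Mapping.keys x \<subseteq> A" "Poly_Mapping.keys y \<subseteq> B"
  shows "tmul x y = (\<Sum>a\<in>A. \<Sum>b\<in>B. Poly_Mapping.single (a + b)
       (Poly_Mapping.lookup x a * Poly_Mapping.lookup y b * qh (Lam a b)))"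
proof -
  have "(\<Sum>b\<in>Poly_Mapping.keys y. Poly_Mapping.single (a + b)
       (Poly_Mapping.lookup x a * Poly_Mapping.lookup y b * qh (Lam a b))) =
      (\<Sum>b\<in>B. Poly_Mapping.single (a + b)
       (Poly_Mapping.lookup x a * Poly_Mapping.lookup y b * qh (Lam a b)))" for a
    using assms by (intro sum.mono_neutral_left) (auto simp: in_keys_iff)
  then show ?thesis
    unfolding tmul_def using assms
    by (simp, intro sum.mono_neutral_left) (auto simp: in_keys_iff)
qed

lemma tmul_add_left: "tmul (x + y) z = tmul x z + tmul y z"
proof -
  let ?A = "Poly_Mapping.keys x \<union> Poly_Mapping.keys y"
  have "Poly_Mapping.keys (x + y) \<subseteq> ?A" by (rule keys_add)
  then show ?thesis
    using tmul_superset[of ?A "Poly_Mapping.keys z" "x + y" z]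
      tmul_superset[of ?A "Poly_Mapping.keys z" x z] tmul_superset[of ?A "Poly_Mapping.keys z" y z]
    by (simp add: lookup_add distrib_right single_add sum.distrib)
qed

lemma tmul_add_right: "tmul z (x + y) = tmul z x + tmul z y"
proof -
  let ?A = "Poly_Mapping.keys x \<union> Poly_Mapping.keys y"
  have "Poly_Mapping.keys (x + y) \<subseteq> ?A" by (rule keys_add)
  then show ?thesis
    using tmul_superset[of "Poly_Mapping.keys z" ?A z "x + y"]
      tmul_superset[of "Poly_Mapping.keys z" ?A z x] tmul_superset[of "Poly_Mapping.keys z" ?A z y]
    by (simp add: lookup_add distrib_left distrib_right single_add sum.distrib)
qed

lemma tmul_0 [simp]: "tmul 0 x = 0" "tmul x 0 = 0"
  by (simp_all add: tmul_def)

lemma tmul_single: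
  "tmul (Poly_Mapping.single a c) (Poly_Mapping.single b d) =
     Poly_Mapping.single (a + b) (c * d * qh (Lam a b))"
  using tmul_superset[of "{a}" "{b}" "Poly_Mapping.single a c" "Poly_Mapping.single b d"]
  by simp

lemma tmul_assoc: "tmul (tmul x y) z = tmul x (tmul y z)"
proof (induction x rule: poly_mapping_add_induct)
  case (monom a c)
  show ?case
  proof (induction y rule: poly_mapping_add_induct)
    case (monom b d)
    show ?case
    proof (induction z rule: poly_mapping_add_induct)
      case (monom e f)
      show ?case
        by (simp add: tmul_single Lam_add qh_add add.assoc mult_ac)
    qed (simp_all add: tmul_add_right)
  qed (simp_all add: tmul_add_left tmul_add_right)
qed (simp_all add: tmul_add_left)

lemma tmul_1: "tmul 1 x = x" "tmul x 1 = x"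
proof -
  have 1: "1 = Poly_Mapping.single (0 :: int \<times> int) (1 :: laurent)" by simp
  show "tmul 1 x = x"
    unfolding 1 by (induction x rule: poly_mapping_add_induct) (simp_all add: tmul_single tmul_add_right del: single_one)
  show "tmul x 1 = x"
    unfolding 1 by (induction x rule: poly_mapping_add_induct) (simp_all add: tmul_single tmul_add_left del: single_one)
qed

instantiation qtorus :: ring_1
begin

lift_definition zero_qtorus :: qtorus is 0 .
lift_definition one_qtorus :: qtorus is 1 .
lift_definition plus_qtorus :: "qtorus \<Rightarrow> qtorus \<Rightarrow> qtorus" is "(+)" .
lift_definition minus_qtorus :: "qtorus \<Rightarrow> qtorus \<Rightarrow> qtorus" is "(-)" .
lift_definition uminus_qtorus :: "qtorus \<Rightarrow> qtorus" is uminus .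
lift_definition times_qtorus :: "qtorus \<Rightarrow> qtorus \<Rightarrow> qtorus" is tmul .

instance
  by standard
    (transfer, simp add: tmul_assoc tmul_1 tmul_add_left tmul_add_right algebra_simps)+

end

definition scl :: "laurent \<Rightarrow> qtorus \<Rightarrow> qtorus" where
  "scl c x = Qtorus (Poly_Mapping.map ((*) c) (coeffs x))"

definition Xm :: "int \<times> int \<Rightarrow> qtorus" where
  "Xm a = Qtorus (Poly_Mapping.single a 1)"

definition tbar :: "qtorus \<Rightarrow> qtorus" where
  "tbar x = Qtorus (Poly_Mapping.map bar (coeffs x))"

lemmas qtorus_coeffs =
  zero_qtorus.rep_eq one_qtorus.rep_eq plus_qtorus.rep_eq minus_qtorus.rep_eq
  uminus_qtorus.rep_eq times_qtorus.rep_eq scl_def Xm_def tbar_def Qtorus_inverse[OF UNIV_I]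

lemma lookup_scl: "Poly_Mapping.lookup (coeffs (scl c x)) a = c * Poly_Mapping.lookup (coeffs x) a"
  by (simp add: qtorus_coeffs Poly_Mapping.map.rep_eq when_def)

lemma lookup_tbar: "Poly_Mapping.lookup (coeffs (tbar x)) a = bar (Poly_Mapping.lookup (coeffs x) a)"
  by (simp add: qtorus_coeffs Poly_Mapping.map.rep_eq when_def)

lemma qtorus_eqI:
  assumes "\<And>a. Poly_Mapping.lookup (coeffs x) a = Poly_Mapping.lookup (coeffs y) a"
  shows "x = y"
  using assms by (metis coeffs_inject poly_mapping_eqI)

interpretation qt: module scl
  by standard
    (rule qtorus_eqI, simp add: lookup_scl plus_qtorus.rep_eq lookup_add algebra_simps)+

lemma Xm_mult: "Xm a * Xm b = scl (qh (Lam a b)) (Xm (a + b))"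
  by (simp add: coeffs_inject[symmetric] qtorus_coeffs tmul_single)

lemma Xm_0: "Xm 0 = 1"
  by (simp add: coeffs_inject[symmetric] qtorus_coeffs)

lemma scl_mult: "scl c x * y = scl c (x * y)" "x * scl c y = scl c (x * y)"
proof -
  have *: "Poly_Mapping.map ((*) c) (u + v) = Poly_Mapping.map ((*) c) u + Poly_Mapping.map ((*) c) v"
    for u v :: "(int \<times> int) \<Rightarrow>\<^sub>0 laurent"
    by (rule poly_mapping_eqI)
      (simp add: Poly_Mapping.map.rep_eq when_def lookup_add flip: distrib_left)
  have 0: "Poly_Mapping.map ((*) c) 0 = (0 :: (int \<times> int) \<Rightarrow>\<^sub>0 laurent)"
    by (rule poly_mapping_eqI) (simp add: Poly_Mapping.map.rep_eq)
  have "tmul (Poly_Mapping.map ((*) c) x) y = Poly_Mapping.map ((*) c) (tmul x y) \<and>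
      tmul x (Poly_Mapping.map ((*) c) y) = Poly_Mapping.map ((*) c) (tmul x y)" for x y
  proof (induction x rule: poly_mapping_add_induct)
    case (monom a d)
    show ?case
    proof (induction y rule: poly_mapping_add_induct)
      case (monom b e)
      show ?case by (simp add: tmul_single mult_ac)
    qed (simp_all add: tmul_add_right 0 *)
  qed (simp_all add: tmul_add_left 0 *)
  then show "scl c x * y = scl c (x * y)" "x * scl c y = scl c (x * y)"
    by (simp_all add: coeffs_inject[symmetric] qtorus_coeffs)
qed

lemma tbar_scl_Xm: "tbar (scl (qh r) (Xm a)) = scl (qh (- r)) (Xm a)"
  by (simp add: coeffs_inject[symmetric] qtorus_coeffs)

lemma tbar_add: "tbar (x + y) = tbar x + tbar y"
  by (rule qtorus_eqI) (simp add: lookup_tbar plus_qtorus.rep_eq lookup_add bar_add)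

text \<open>
  The exchange relations are imposed inside the quantum torus rather than in its skew field of
  fractions: the cluster variables lie in the torus by the Laurent phenomenon, and since the torus is
  a domain the relations determine them there.
\<close>

definition cluster_family :: "laurent \<Rightarrow> (int \<Rightarrow> qtorus) \<Rightarrow> bool" where
  "cluster_family h X \<longleftrightarrow>
     X 1 = Xm (1, 0) \<and> X 2 = Xm (0, 1) \<and>
     (\<forall>k. X (k - 1) * X (k + 1) = scl (qh 2) (X k ^ 2) + scl (qh 1 * h) (X k) + 1)"

definition cluster_var :: "laurent \<Rightarrow> int \<Rightarrow> qtorus" where
  "cluster_var h = (THE X. cluster_family h X)"

definition subalgebra :: "qtorus set \<Rightarrow> bool" where
  "subalgebra S \<longleftrightarrow> qt.subspace S \<and> 1 \<in> S \<and> (\<forall>x\<in>S. \<forall>y\<in>S. x * y \<in> S)"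

definition Aq :: "laurent \<Rightarrow> qtorus set" where
  "Aq h = subalgebra hull range (cluster_var h)"

definition Xdelta :: "laurent \<Rightarrow> qtorus" where
  "Xdelta h = scl (qh 1) (cluster_var h 0 * cluster_var h 3)
     - scl (qh 1) ((scl (qh 1) (cluster_var h 1) + scl h 1) * (scl (qh 1) (cluster_var h 2) + scl h 1))"

fun cheb :: "nat \<Rightarrow> 'a::ring_1 \<Rightarrow> 'a" where
  "cheb 0 x = 1"
| "cheb (Suc 0) x = x"
| "cheb (Suc (Suc 0)) x = x ^ 2 - 2"
| "cheb (Suc (Suc (Suc n))) x = cheb (Suc (Suc n)) x * x - cheb (Suc n) x"

definition cluster_monomials :: "laurent \<Rightarrow> qtorus set" where
  "cluster_monomials h =
     {scl (qh (- int (a1 * a2))) (cluster_var h m ^ a1 * cluster_var h (m + 1) ^ a2) | m a1 a2. True}"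

definition delta_elements :: "laurent \<Rightarrow> qtorus set" where
  "delta_elements h = {cheb n (Xdelta h) | n. n > 0}"

definition basis_B :: "laurent \<Rightarrow> qtorus set" where
  "basis_B h = cluster_monomials h \<union> delta_elements h"

text \<open>
  $\mathbb{Z}_{\ge 0}[q^{\pm 1/2}, h]$: values of polynomials in three variables with natural number
  coefficients at $q^{1/2}$, $q^{-1/2}$, $h$.
\<close>

definition nonneg_poly :: "laurent \<Rightarrow> laurent set" where
  "nonneg_poly h =
     {\<Sum>(i, j, k)\<in>S. of_nat (c i j k) * qh 1 ^ i * qh (- 1) ^ j * h ^ k
       | (S :: (nat \<times> nat \<times> nat) set) (c :: nat \<Rightarrow> nat \<Rightarrow> nat \<Rightarrow> nat). finite S}"

end

theory Submission
  imports Defs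
begin

text \<open>
  Write $\delta = X_\delta$. The cluster variables satisfy the linear recursion
  $X_k \delta = q^{-1/2} X_{k-1} + q^{1/2} X_{k+1} + h$ and its bar image, and building the family from
  this recursion gives bar-invariance, the commutation $X_k X_{k+1} = q X_{k+1} X_k$ and the exchange
  relations by induction. Iterating it yields subtraction-free formulas: $X_k F_n(\delta)$ is
  $q^{-n/2} X_{k-n} + q^{n/2} X_{k+n}$ plus $h$ times a non-negative combination of Chebyshev polynomials
  of the second kind, and for $n \ge 2$ the product $X_k X_{k+n}$ is $q X_{k+1} X_{k+n-1}$ plus
  non-negative terms with at most one cluster variable. A word $X_{k_1} \cdots X_{k_r}$ is therefore
  straightened by moving two letters with a gap of at least 2 towards each other, which lowers
  $\sum k_i^2$. Linear independence holds because every basis element has a componentwise smallest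
  exponent with unit coefficient, and these exponents are pairwise distinct.
\<close>

section \<open>Scalars and the bar anti-automorphism of the quantum torus\<close>

lemma qh_mult: "qh r * qh s = qh (r + s)" "qh r * (qh s * c) = qh (r + s) * c"
  by (simp_all add: qh_add mult.assoc)

lemmas scl_simps = scl_mult qt.scale_right_distrib qt.scale_right_diff_distrib qt.scale_left_distrib
  qt.scale_left_diff_distrib distrib_left distrib_right left_diff_distrib right_diff_distrib

lemma qh_neq_0: "qh r \<noteq> 0"
  by (simp add: qh_def)

lemma scl_qh_cancel: "scl (qh r) x = scl (qh r) y \<longleftrightarrow> x = y"
proof
  assume "scl (qh r) x = scl (qh r) y"
  then have "scl (qh (- r)) (scl (qh r) x) = scl (qh (- r)) (scl (qh r) y)" by simp
  then show "x = y" by (simp add: qh_mult)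
qed simp

lemma tbar_0 [simp]: "tbar 0 = 0"
  by (rule qtorus_eqI) (simp add: lookup_tbar zero_qtorus.rep_eq)

lemma tbar_scl: "tbar (scl c x) = scl (bar c) (tbar x)"
  by (rule qtorus_eqI) (simp add: lookup_tbar lookup_scl bar_mult)

lemma tbar_Xm [simp]: "tbar (Xm a) = Xm a"
  using tbar_scl_Xm[of 0] by simp

lemma tbar_1 [simp]: "tbar 1 = 1"
  using tbar_Xm[of 0] by (simp only: Xm_0)

abbreviation tcoeff :: "qtorus \<Rightarrow> int \<times> int \<Rightarrow> laurent" where
  "tcoeff x \<equiv> Poly_Mapping.lookup (coeffs x)"

text \<open>Reduces additive statements to scaled monomials, where the twisted product is a single
  term.\<close>

lemma qtorus_induct [case_names zero monom add]:
  assumes "P 0" and "\<And>a c. P (scl c (Xm a))" and "\<And>x y. P x \<Longrightarrow> P y \<Longrightarrow> P (x + y)"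
  shows "P x"
proof -
  have Q: "Qtorus p + Qtorus p' = Qtorus (p + p')" for p p'
    by (simp add: coeffs_inject[symmetric] qtorus_coeffs)
  have 0: "Qtorus 0 = 0"
    by (simp add: coeffs_inject[symmetric] qtorus_coeffs)
  have s: "Qtorus (Poly_Mapping.single a c) = scl c (Xm a)" for a c
    by (simp add: coeffs_inject[symmetric] qtorus_coeffs)
  have "P (Qtorus p)" for p
  proof (induction p rule: poly_mapping_add_induct)
    case (add p p') then show ?case using assms(3) by (simp flip: Q)
  qed (simp_all add: 0 s assms)
  then show ?thesis by (metis coeffs_inverse)
qed

text \<open>Swapping two monomials changes the sign of \<open>Lam\<close>, exactly as bar inverts
  the power of \<open>q^{1/2}\<close>.\<close>

lemma tbar_mult: "tbar (x * y) = tbar y * tbar x"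
proof (induction x rule: qtorus_induct)
  case (monom a c)
  show ?case
  proof (induction y rule: qtorus_induct)
    case (monom b d)
    have "Lam b a = - Lam a b" by (simp add: Lam_def)
    then show ?case
      by (simp add: tbar_scl scl_mult Xm_mult bar_mult mult_ac add.commute)
  qed (simp_all add: tbar_add scl_simps)
qed (simp_all add: tbar_add scl_simps)

lemma tbar_diff: "tbar (x - y) = tbar x - tbar y"
  by (metis add_diff_cancel diff_add_cancel tbar_add)

subsection \<open>Lowest exponents\<close>

definition above :: "int \<times> int \<Rightarrow> qtorus \<Rightarrow> bool" where
  "above p x \<longleftrightarrow>
     (\<forall>a. tcoeff x a \<noteq> 0 \<longrightarrow> fst p \<le> fst a \<and> snd p \<le> snd a)"

text \<open>Asking for a power of \<open>q^{1/2}\<close> provides a unit coefficient: the notion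
  survives twisted products, and the coefficient can be cancelled.\<close>

definition lowest :: "int \<times> int \<Rightarrow> qtorus \<Rightarrow> bool" where
  "lowest p x \<longleftrightarrow> above p x \<and> (\<exists>r. tcoeff x p = qh r)"

lemma aboveD:
  "above p x \<Longrightarrow> tcoeff x a \<noteq> 0 \<Longrightarrow> fst p \<le> fst a \<and> snd p \<le> snd a"
  unfolding above_def by blast

lemma lookup_mult:
  assumes "finite A" "\<And>a. tcoeff x a \<noteq> 0 \<Longrightarrow> a \<in> A"
  shows "tcoeff (x * y) e =
    (\<Sum>a\<in>A. tcoeff x a * tcoeff y (e - a) * qh (Lam a (e - a)))"
proof -
  let ?B = "Poly_Mapping.keys (coeffs y)"
  have "tcoeff (x * y) e = (\<Sum>a\<in>A. \<Sum>b\<in>?B. Poly_Mapping.lookup (Poly_Mapping.single (a + b)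
       (tcoeff x a * tcoeff y b * qh (Lam a b))) e)"
    using assms
    by (subst times_qtorus.rep_eq, subst tmul_superset[of A ?B]) (auto simp: lookup_sum in_keys_iff)
  also have "\<dots> = (\<Sum>a\<in>A. \<Sum>b\<in>?B. if b = e - a then
       (tcoeff x a * tcoeff y b * qh (Lam a b)) else 0)"
    by (intro sum.cong refl) (auto simp: lookup_single when_def)
  also have "\<dots> = (\<Sum>a\<in>A. tcoeff x a * tcoeff y (e - a) * qh (Lam a (e - a)))"
    by (intro sum.cong refl) (auto simp: in_keys_iff)
  finally show ?thesis .
qed

lemma finite_support: "finite {a. tcoeff x a \<noteq> 0}"
  by simp

lemma above_mult:
  assumes "above p x" "above p' y"
  shows "above (p + p') (x * y)"
  unfolding above_def
proof (intro allI impI)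
  fix e
  assume ne: "tcoeff (x * y) e \<noteq> 0"
  then obtain a where "tcoeff x a * tcoeff y (e - a) * qh (Lam a (e - a)) \<noteq> 0"
    using lookup_mult[OF finite_support, of x x y e]
    by (metis (mono_tags, lifting) mem_Collect_eq sum.neutral)
  then have "tcoeff x a \<noteq> 0" "tcoeff y (e - a) \<noteq> 0"
    by auto
  then show "fst (p + p') \<le> fst e \<and> snd (p + p') \<le> snd e"
    using aboveD[OF assms(1), of a] aboveD[OF assms(2), of "e - a"] by simp
qed

text \<open>Only the pair \<open>(p, p')\<close> contributes: any other pair with the same sum would
  put one factor outside its componentwise bound.\<close>

lemma lookup_mult_above:
  assumes "above p x" "above p' y"
  shows "tcoeff (x * y) (p + p') =
    tcoeff x p * tcoeff y p' * qh (Lam p p')"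
proof -
  let ?A = "insert p {a. tcoeff x a \<noteq> 0}"
  have 0: "tcoeff x a * tcoeff y (p + p' - a) = 0" if "a \<noteq> p" for a
  proof (rule ccontr)
    assume "\<not> ?thesis"
    then have "tcoeff x a \<noteq> 0" "tcoeff y (p + p' - a) \<noteq> 0"
      by auto
    then show False
      using aboveD[OF assms(1), of a] aboveD[OF assms(2), of "p + p' - a"] that
      by (simp add: prod_eq_iff)
  qed
  have "tcoeff (x * y) (p + p') =
    (\<Sum>a\<in>?A. tcoeff x a * tcoeff y (p + p' - a) * qh (Lam a (p + p' - a)))"
    by (rule lookup_mult) auto
  also have "\<dots> = (\<Sum>a\<in>{p}. tcoeff x a * tcoeff y (p + p' - a) * qh (Lam a (p + p' - a)))"
    by (rule sum.mono_neutral_right) (auto simp: 0)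
  finally show ?thesis by simp
qed

lemma lowest_mult: "lowest p x \<Longrightarrow> lowest p' y \<Longrightarrow> lowest (p + p') (x * y)"
  unfolding lowest_def by (metis above_mult lookup_mult_above qh_add)

lemma lowest_scl: "lowest p x \<Longrightarrow> lowest p (scl (qh r) x)"
  unfolding lowest_def above_def by (auto simp: lookup_scl qh_add[symmetric])

lemma lowest_Xm: "lowest p (Xm p)"
  unfolding lowest_def above_def
  by (auto simp: qtorus_coeffs lookup_single when_def intro: exI[of _ 0])

lemma lowest_power: "lowest p x \<Longrightarrow> lowest (int n * fst p, int n * snd p) (x ^ n)"
proof (induction n)
  case 0
  then show ?case using lowest_Xm[of 0] by (simp add: Xm_0) (simp add: zero_prod_def)
next
  case (Suc n)
  then show ?case using lowest_mult[of p x] by (fastforce simp: algebra_simps plus_prod_def)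
qed

lemma above_mono: "above p x \<Longrightarrow> fst p' \<le> fst p \<Longrightarrow> snd p' \<le> snd p \<Longrightarrow> above p' x"
  unfolding above_def by force

lemma above_scl: "above p x \<Longrightarrow> above p (scl c x)"
  unfolding above_def by (auto simp: lookup_scl)

lemma above_diff: "above p x \<Longrightarrow> above p y \<Longrightarrow> above p (x - y)"
  unfolding above_def by (metis cancel_comm_monoid_add_class.diff_cancel lookup_minus minus_qtorus.rep_eq)

lemma above_add: "above p x \<Longrightarrow> above p y \<Longrightarrow> above p (x + y)"
  unfolding above_def by (metis add.right_neutral lookup_add plus_qtorus.rep_eq)

lemma lowest_above: "lowest p x \<Longrightarrow> above p x"
  by (simp add: lowest_def)

lemma lowest_add_above:
  assumes "lowest p x" "above p' y" "fst p \<le> fst p'" "snd p \<le> snd p'" "p \<noteq> p'"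
  shows "lowest p (x + y)" "lowest p (x - y)"
proof -
  have "tcoeff y p = 0"
    using assms unfolding above_def by (metis antisym prod_eq_iff)
  then show "lowest p (x + y)" "lowest p (x - y)"
    using assms above_mono[of p' y p] above_add[of p x y] above_diff[of p x y] unfolding lowest_def
    by (auto simp: minus_qtorus.rep_eq lookup_minus plus_qtorus.rep_eq lookup_add)
qed

lemma lowest_unique: "lowest p x \<Longrightarrow> lowest p' x \<Longrightarrow> p = p'"
  unfolding lowest_def above_def by (metis antisym prod_eq_iff qh_neq_0)

text \<open>Minimizing the sum of the coordinates picks out a term that nothing else can cancel.\<close>

lemma lowest_left_regular:
  assumes "lowest p x" "x * y = x * z"
  shows "y = z"
proof (rule ccontr)
  let ?w = "y - z"
  let ?S = "{a. tcoeff ?w a \<noteq> 0}"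
  assume "y \<noteq> z"
  then have "?S \<noteq> {}"
    by (metis (mono_tags, lifting) Collect_empty_eq coeffs_inject lookup_zero poly_mapping_eqI right_minus_eq zero_qtorus.rep_eq)
  then obtain m where m: "m \<in> ?S" "\<And>a. a \<in> ?S \<Longrightarrow> fst m + snd m \<le> fst a + snd a"
    using ex_is_arg_min_if_finite[OF finite_support, of ?w "\<lambda>a. fst a + snd a"]
    unfolding is_arg_min_def by (metis (no_types, lifting) not_less)
  let ?A = "insert p {a. tcoeff x a \<noteq> 0}"
  have 0: "tcoeff x a * tcoeff ?w (p + m - a) = 0" if "a \<noteq> p" for a
  proof (rule ccontr)
    assume "\<not> ?thesis"
    then have "tcoeff x a \<noteq> 0" "p + m - a \<in> ?S"
      by auto
    with m(2)[of "p + m - a"] aboveD[of p x a] assms(1) that show False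
      by (simp add: lowest_def prod_eq_iff)
  qed
  have "tcoeff (x * ?w) (p + m) =
    (\<Sum>a\<in>?A. tcoeff x a * tcoeff ?w (p + m - a) * qh (Lam a (p + m - a)))"
    by (rule lookup_mult) auto
  also have "\<dots> = (\<Sum>a\<in>{p}. tcoeff x a * tcoeff ?w (p + m - a) * qh (Lam a (p + m - a)))"
    by (rule sum.mono_neutral_right) (auto simp: 0)
  also have "\<dots> = tcoeff x p * (tcoeff ?w m * qh (Lam p m))"
    by (simp add: mult.assoc)
  finally have c: "tcoeff (x * ?w) (p + m) =
    tcoeff x p * (tcoeff ?w m * qh (Lam p m))" .
  obtain r where r: "tcoeff x p = qh r"
    using assms(1) by (auto simp: lowest_def)
  have "x * ?w = 0" using assms(2) by (simp add: right_diff_distrib)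
  then have "qh r * (tcoeff ?w m * qh (Lam p m)) = 0"
    using c by (simp add: r zero_qtorus.rep_eq)
  \<comment> \<open>Powers of \<open>q^{1/2}\<close> are units, so multiplying by the inverses
    isolates the coefficient.\<close>
  then have "qh (- Lam p m - r) * (qh r * (qh (Lam p m) * tcoeff ?w m)) = 0"
    by (simp add: mult.commute)
  then have "tcoeff ?w m = 0"
    by (simp only: qh_mult) simp
  then show False using m(1) by simp
qed

text \<open>Among the terms with nonzero scalar pick one whose lowest exponent has minimal
  coordinate sum. Another term reaching that exponent would have its own lowest exponent
  componentwise below it, hence equal to it by minimality, against \<open>inj\<close>. The unit
  coefficient left over forces the scalar to vanish.\<close>

lemma independent_lowest:
  assumes B: "\<And>b. b \<in> B \<Longrightarrow> \<exists>p. lowest p b"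
    and inj: "\<And>b b' p. b \<in> B \<Longrightarrow> b' \<in> B \<Longrightarrow> lowest p b \<Longrightarrow> lowest p b' \<Longrightarrow> b = b'"
  shows "qt.independent B"
  unfolding qt.dependent_explicit
proof (clarify)
  fix t u b0
  assume t: "finite t" "t \<subseteq> B" and s: "(\<Sum>v\<in>t. scl (u v) v) = 0" and b0: "b0 \<in> t" "u b0 \<noteq> 0"
  obtain p where p: "\<And>b. b \<in> B \<Longrightarrow> lowest (p b) b" using B by metis
  let ?T = "{b \<in> t. u b \<noteq> 0}"
  obtain m where m: "m \<in> ?T" "\<And>a. a \<in> ?T \<Longrightarrow> fst (p m) + snd (p m) \<le> fst (p a) + snd (p a)"
    using ex_is_arg_min_if_finite[of ?T "\<lambda>a. fst (p a) + snd (p a)"] b0 t(1)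
    by (auto simp: is_arg_min_def not_less)
  have 0: "u b * tcoeff b (p m) = 0" if b: "b \<in> t" "b \<noteq> m" for b
  proof (rule ccontr)
    assume ne: "\<not> ?thesis"
    then have ub: "b \<in> ?T" "tcoeff b (p m) \<noteq> 0" using b by auto
    have "lowest (p b) b" "lowest (p m) m" using p t b m by auto
    with ub(2) m(2)[OF ub(1)] aboveD[of "p b" b "p m"] have "p b = p m"
      by (simp add: lowest_def prod_eq_iff)
    moreover have "b \<in> B" "m \<in> B" using t b m(1) by auto
    ultimately show False using inj[of b m "p m"] p b by metis
  qed
  have "0 = tcoeff (\<Sum>v\<in>t. scl (u v) v) (p m)"
    by (simp add: s zero_qtorus.rep_eq)
  also have "\<dots> = (\<Sum>v\<in>t. u v * tcoeff v (p m))"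
    using t(1) by (induction t rule: finite_induct)
      (simp_all add: zero_qtorus.rep_eq plus_qtorus.rep_eq lookup_add lookup_scl)
  also have "\<dots> = (\<Sum>v\<in>{m}. u v * tcoeff v (p m))"
    by (rule sum.mono_neutral_right) (use t m 0 in auto)
  finally have z: "u m * tcoeff m (p m) = 0" by simp
  obtain r where "tcoeff m (p m) = qh r"
    using p[of m] m t by (auto simp: lowest_def)
  with z have "qh (-r) * (qh r * u m) = 0" by (simp add: mult.commute)
  then have "u m = 0" by (simp add: qh_mult)
  then show False using m(1) by simp
qed

subsection \<open>Construction of the cluster variables\<close>

text \<open>The Laurent expansion of \<open>X_delta\<close>, confirmed by
  \<open>delta_elt_eq\<close>. Fixing it in the torus first lets the linear recursion define the
  cluster variables without division.\<close>

definition delta_elt :: "laurent \<Rightarrow> qtorus" where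
  "delta_elt h = Xm (1, -1) + Xm (-1, 1) + Xm (-1, -1) + scl h (Xm (0, -1)) + scl h (Xm (-1, 0))"

text \<open>The recursion for \<open>X_k delta\<close> solved for \<open>X_{k+1}\<close>; index
  \<open>n\<close> stands for \<open>X_{n+1}\<close>.\<close>

fun var_up :: "laurent \<Rightarrow> nat \<Rightarrow> qtorus" where
  "var_up h 0 = Xm (1, 0)"
| "var_up h (Suc 0) = Xm (0, 1)"
| "var_up h (Suc (Suc n)) =
     scl (qh (-1)) (var_up h (Suc n) * delta_elt h) - scl (qh (-2)) (var_up h n) - scl (qh (-1) * h) 1"

text \<open>The same recursion solved for \<open>X_{k-1}\<close>; index \<open>n\<close> stands for
  \<open>X_{2-n}\<close>.\<close>

fun var_down :: "laurent \<Rightarrow> nat \<Rightarrow> qtorus" where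
  "var_down h 0 = Xm (0, 1)"
| "var_down h (Suc 0) = Xm (1, 0)"
| "var_down h (Suc (Suc n)) =
     scl (qh 1) (var_down h (Suc n) * delta_elt h) - scl (qh 2) (var_down h n) - scl (qh 1 * h) 1"

definition var :: "laurent \<Rightarrow> int \<Rightarrow> qtorus" where
  "var h k = (if k \<ge> 1 then var_up h (nat (k - 1)) else var_down h (nat (2 - k)))"

lemma var_1: "var h 1 = Xm (1, 0)" and var_2: "var h 2 = Xm (0, 1)"
  by (simp_all add: var_def)

lemma Xm_pair_mult: "Xm (a, b) * Xm (c, d) = scl (qh (a * d - b * c)) (Xm (a + c, b + d))"
  by (simp add: Xm_mult Lam_def)

lemma one_Xm: "1 = Xm (0, 0)"
  by (simp add: Xm_0 flip: zero_prod_def)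

lemma var_mult_delta:
  "var h k * delta_elt h = scl (qh (-1)) (var h (k - 1)) + scl (qh 1) (var h (k + 1)) + scl h 1"
proof (cases "k \<ge> 2")
  case True
  then obtain n where k: "k = int n + 2" by (metis nat_eq_iff2 add.commute le_iff_add zle_iff_zadd)
  then have "nat (k - 1) = Suc n" "nat (k - 1 - 1) = n" "nat (k + 1 - 1) = Suc (Suc n)"
    by auto
  then show ?thesis using k
    by (simp add: var_def scl_simps qh_mult mult_ac)
next
  case False
  define n where "n = nat (1 - k)"
  have k: "k = 1 - int n" using False by (simp add: n_def)
  \<comment> \<open>Both one-sided families contain \<open>X_1\<close> and \<open>X_2\<close>, so
    the downward description is still valid at index 2, which occurs here as
    \<open>k + 1\<close>.\<close>
  have *: "var h j = var_down h (nat (2 - j))" if "j \<le> 2" for j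
    using that by (cases "j = 1"; cases "j = 2") (auto simp: var_def)
  have "nat (2 - k) = Suc n" "nat (2 - (k - 1)) = Suc (Suc n)" "nat (2 - (k + 1)) = n"
    using k by auto
  then show ?thesis using False
    by (simp add: * scl_simps qh_mult mult_ac)
qed

lemma var_0: "var h 0 = Xm (2, -1) + scl h (Xm (1, -1)) + Xm (0, -1)"
  using var_mult_delta[of h 1]
  by (simp add: var_def numeral_2_eq_2[symmetric])
   (simp add: numeral_2_eq_2 delta_elt_def one_Xm scl_simps Xm_pair_mult qh_mult mult_ac)

lemma var_3: "var h 3 = Xm (-1, 2) + scl h (Xm (-1, 1)) + Xm (-1, 0)"
  by (simp add: var_def numeral_2_eq_2)
   (simp add: numeral_2_eq_2 delta_elt_def one_Xm scl_simps Xm_pair_mult qh_mult mult_ac)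

lemma delta_elt_eq:
  "delta_elt h = scl (qh 1) (var h 0 * var h 3)
     - scl (qh 1) ((scl (qh 1) (var h 1) + scl h 1) * (scl (qh 1) (var h 2) + scl h 1))"
  by (simp add: delta_elt_def one_Xm var_0 var_1 var_2 var_3 scl_simps Xm_pair_mult qh_mult mult_ac)

lemma delta_mult_var_1_2:
  "delta_elt h * var h 1 = scl (qh 1) (var h 0) + scl (qh (-1)) (var h 2) + scl h 1"
  "delta_elt h * var h 2 = scl (qh 1) (var h 1) + scl (qh (-1)) (var h 3) + scl h 1"
  by (simp_all add: delta_elt_def one_Xm var_0 var_1 var_2 var_3 scl_simps Xm_pair_mult qh_mult mult_ac)

text \<open>Evaluating \<open>delta X_k delta\<close> in both bracketings turns the left recursion
  at \<open>k\<close> into a relation between those at \<open>k - 1\<close> and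
  \<open>k + 1\<close>, so it propagates in both directions from two consecutive indices.\<close>

lemma delta_mult_var:
  "delta_elt h * var h k = scl (qh 1) (var h (k - 1)) + scl (qh (-1)) (var h (k + 1)) + scl h 1"
proof -
  let ?L = "\<lambda>k. delta_elt h * var h k = scl (qh 1) (var h (k - 1)) + scl (qh (-1)) (var h (k + 1)) + scl h 1"
  have I: "scl (qh (-1)) (delta_elt h * var h (k - 1)) + scl (qh 1) (delta_elt h * var h (k + 1))
     = scl (qh 1) (var h (k - 1) * delta_elt h) + scl (qh (-1)) (var h (k + 1) * delta_elt h)"
    if "?L k" for k
  proof -
    have "delta_elt h * var h k * delta_elt h = delta_elt h * (var h k * delta_elt h)"
      by (rule mult.assoc)
    then show ?thesis
      unfolding that var_mult_delta[of h k] by (simp add: scl_simps)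
  qed
  have up: "?L (k + 1)" if "?L (k - 1)" "?L k" for k
  proof -
    have "scl (qh 1) (delta_elt h * var h (k + 1)) = scl (qh 1) (scl (qh 1) (var h k) + scl (qh (-1)) (var h (2 + k)) + scl h 1)"
      using I[OF that(2)] unfolding that(1) var_mult_delta
      by (simp add: scl_simps qh_mult mult_ac)
    then show ?thesis by (simp add: scl_qh_cancel)
  qed
  have down: "?L (k - 1)" if "?L (k + 1)" "?L k" for k
  proof -
    have "scl (qh (-1)) (delta_elt h * var h (k - 1)) = scl (qh (-1)) (scl (qh 1) (var h (k - 2)) + scl (qh (-1)) (var h k) + scl h 1)"
      using I[OF that(2)] unfolding that(1) var_mult_delta
      by (simp add: scl_simps qh_mult mult_ac)
    then show ?thesis by (simp add: scl_qh_cancel)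
  qed
  have "?L k \<and> ?L (k + 1)"
  proof (induction k rule: int_induct[where k = 1])
    case base then show ?case using delta_mult_var_1_2[of h] by simp
  next
    case (step1 i) then show ?case using up[of "i + 1"] by simp
  next
    case (step2 i) then show ?case using down[of i] by simp
  qed
  then show ?thesis by simp
qed

lemma tbar_delta:
  assumes "bar h = h"
  shows "tbar (delta_elt h) = delta_elt h"
  by (simp add: delta_elt_def tbar_add tbar_scl assms)

text \<open>Bar maps the right recursion to one that can be compared with the left recursion: once
  \<open>X_k\<close> is invariant, invariance of either neighbour gives that of the other.\<close>

lemma tbar_var:
  assumes h: "bar h = h"
  shows "tbar (var h k) = var h k"
proof -
  have I: "scl (qh 1) (tbar (var h (k - 1))) + scl (qh (-1)) (tbar (var h (k + 1)))
    = scl (qh 1) (var h (k - 1)) + scl (qh (-1)) (var h (k + 1))" if "tbar (var h k) = var h k" for k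
    using arg_cong[OF var_mult_delta[of h k], of tbar] delta_mult_var[of h k]
    by (simp add: tbar_mult tbar_add tbar_scl h that tbar_delta)
  have "tbar (var h k) = var h k \<and> tbar (var h (k + 1)) = var h (k + 1)"
  proof (induction k rule: int_induct[where k = 1])
    case base then show ?case by (simp add: var_1 var_2)
  next
    case (step1 i) then show ?case using I[of "i + 1"] by (simp add: scl_qh_cancel)
  next
    case (step2 i) then show ?case using I[of i] by (simp add: scl_qh_cancel)
  qed
  then show ?thesis by simp
qed

text \<open>Both bracketings of \<open>X_k delta X_k\<close> show that the defect
  \<open>X_k X_{k+1} - q X_{k+1} X_k\<close> equals the one at \<open>k - 1\<close>; it vanishes at
  \<open>k = 1\<close>.\<close>

lemma var_commute: "var h k * var h (k + 1) = scl (qh 2) (var h (k + 1) * var h k)"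
proof -
  let ?C = "\<lambda>k. var h k * var h (k + 1) = scl (qh 2) (var h (k + 1) * var h k)"
  have step: "?C (k - 1) \<longleftrightarrow> ?C k" for k
  proof -
    let ?d = "delta_elt h"
    have "var h k * ?d * var h k = var h k * (?d * var h k)" by (rule mult.assoc)
    then have "scl (qh (-1)) (var h (k - 1) * var h k) + scl (qh 1) (var h (k + 1) * var h k)
      = scl (qh 1) (var h k * var h (k - 1)) + scl (qh (-1)) (var h k * var h (k + 1))"
      unfolding var_mult_delta delta_mult_var by (simp add: scl_simps)
    then have *: "scl (qh (-1)) (var h (k - 1) * var h k) - scl (qh (-1)) (scl (qh 2) (var h k * var h (k - 1)))
      = scl (qh (-1)) (var h k * var h (k + 1)) - scl (qh (-1)) (scl (qh 2) (var h (k + 1) * var h k))"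
      by (simp add: qh_mult algebra_simps)
    show ?thesis
      using * by (metis diff_add_cancel eq_iff_diff_eq_0 scl_qh_cancel)
  qed
  show ?thesis
  proof (induction k rule: int_induct[where k = 1])
    case base then show ?case by (simp add: var_1 var_2 Xm_pair_mult qh_mult)
  next
    case (step1 i) then show ?case using step[of "i + 1"] by simp
  next
    case (step2 i) then show ?case using step[of i] by simp
  qed
qed

text \<open>Multiplying the commutation relation of \<open>X_k\<close> and \<open>X_{k+1}\<close> by
  delta on the right makes exchange at \<open>k + 1\<close> equivalent to the bar image of exchange
  at \<open>k\<close>. Bar-invariance of the variables removes the bar.\<close>

lemma var_exchange:
  assumes h: "bar h = h"
  shows "var h (k - 1) * var h (k + 1) = scl (qh 2) (var h k ^ 2) + scl (qh 1 * h) (var h k) + 1"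
proof -
  let ?E = "\<lambda>k. var h (k - 1) * var h (k + 1) = scl (qh 2) (var h k ^ 2) + scl (qh 1 * h) (var h k) + 1"
  let ?E' = "\<lambda>k. var h (k + 1) * var h (k - 1) = scl (qh (-2)) (var h k ^ 2) + scl (qh (-1) * h) (var h k) + 1"
  have bar: "?E k \<longleftrightarrow> ?E' k" for k
  proof -
    have "tbar (var h (k - 1) * var h (k + 1)) = var h (k + 1) * var h (k - 1)"
      by (simp add: tbar_mult tbar_var h)
    moreover have "tbar (scl (qh 2) (var h k ^ 2) + scl (qh 1 * h) (var h k) + 1)
      = scl (qh (-2)) (var h k ^ 2) + scl (qh (-1) * h) (var h k) + 1"
      by (simp add: tbar_mult tbar_var tbar_add tbar_scl h bar_mult power2_eq_square)
    moreover have "tbar x = tbar y \<longleftrightarrow> x = y" for x y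
      by (metis bar_bar lookup_tbar qtorus_eqI)
    ultimately show ?thesis by metis
  qed
  have *: "var h k * var h (2 + k) + scl (qh (-2)) (var h k ^ 2) + scl (qh (-1) * h) (var h k)
    = var h (k + 1) * var h (k - 1) + scl (qh 2) (var h (k + 1) ^ 2) + scl (qh 1 * h) (var h (k + 1))" for k
  proof -
    let ?d = "delta_elt h"
    have "var h k * (var h (k + 1) * ?d) = scl (qh 2) (var h (k + 1) * (var h k * ?d))"
      by (simp add: var_commute scl_simps flip: mult.assoc)
    then have "scl (qh (-1)) (var h k * (var h (k + 1) * ?d)) = scl (qh (-1)) (scl (qh 2) (var h (k + 1) * (var h k * ?d)))"
      by simp
    then show ?thesis unfolding var_mult_delta
      by (simp add: scl_simps qh_mult power2_eq_square mult_ac add_ac)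
  qed
  have step: "?E (k + 1) \<longleftrightarrow> ?E k" for k
  proof -
    have "a = s + t + 1 \<longleftrightarrow> b = u + v + 1" if "a + u + v = b + s + t" for a b s t u v :: qtorus
    proof -
      have "a - (s + t + 1) = b - (u + v + 1)" using that by (simp add: algebra_simps)
      then show ?thesis by (metis right_minus_eq)
    qed
    from this[OF *[of k]] have "?E (k + 1) \<longleftrightarrow> ?E' k"
      by simp
    then show ?thesis by (simp add: bar)
  qed
  show ?thesis
  proof (induction k rule: int_induct[where k = 1])
    case base
    then show ?case
      by (simp add: var_0 var_1 var_2 one_Xm power2_eq_square scl_simps Xm_pair_mult qh_mult mult_ac)
  next
    case (step1 i) then show ?case using step[of "i"] by simp
  next
    case (step2 i) then show ?case using step[of "i - 1"] by simp
  qed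
qed

subsection \<open>Lowest exponents of the cluster variables\<close>

lemma lowest_delta: "lowest (-1, -1) (delta_elt h)"
proof -
  have "lowest (-1, -1) (Xm (-1, -1) + (Xm (1, -1) + Xm (-1, 1) + scl h (Xm (0, -1)) + scl h (Xm (-1, 0))))"
    (is "lowest _ (_ + ?y)")
  proof -
    have "above (-1, -1) ?y"
      by (intro above_add above_scl) (rule above_mono[OF lowest_above[OF lowest_Xm]]; simp)+
    moreover have "tcoeff ?y (-1, -1) = 0"
      by (simp add: plus_qtorus.rep_eq lookup_add lookup_scl)
        (simp add: Xm_def Qtorus_inverse lookup_single)
    ultimately show ?thesis
      using above_add[OF lowest_above[OF lowest_Xm], of "(-1,-1)" ?y] lowest_Xm[of "(-1,-1)"]
      unfolding lowest_def by (simp add: plus_qtorus.rep_eq lookup_add)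
  qed
  then show ?thesis by (simp add: delta_elt_def add_ac)
qed

lemma lowest_one: "lowest (0, 0) 1"
  using lowest_Xm[of "(0, 0)"] by (simp only: one_Xm)

text \<open>Multiplying by delta shifts the lowest exponent by \<open>(-1, -1)\<close>. The
  induction also carries a bound on the previous variable, so that neither it nor the constant
  reaches the new exponent.\<close>

lemma lowest_var_up: "lowest (- int n, 1 - int n) (var h (int n + 2))"
proof -
  have "lowest (- int n, 1 - int n) (var h (int n + 2)) \<and> above (- int n, - int n) (var h (int n + 1))"
  proof (induction n)
    case 0
    have "above (0, 0) (var h 1)"
      unfolding var_1 by (rule above_mono[OF lowest_above[OF lowest_Xm]]) auto
    then show ?case by (simp add: var_2 lowest_Xm)
  next
    case (Suc n)
    let ?k = "int n + 2"
    have eq: "var h (?k + 1) = scl (qh (-1)) (var h ?k * delta_elt h)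
      - (scl (qh (-2)) (var h (?k - 1)) + scl (qh (-1) * h) 1)"
      by (simp add: var_mult_delta scl_simps qh_mult mult_ac)
    have 1: "lowest (- int n - 1, - int n) (scl (qh (-1)) (var h ?k * delta_elt h))"
      using lowest_scl[OF lowest_mult[OF conjunct1[OF Suc.IH] lowest_delta[of h]], of "-1"] by simp
    have 2: "above (- int n, - int n) (scl (qh (-2)) (var h (?k - 1)) + scl (qh (-1) * h) 1)"
      using Suc.IH
      by (intro above_add above_scl above_mono[OF lowest_above[OF lowest_one]]) (auto simp: add.commute)
    have "lowest (- int n - 1, - int n) (var h (?k + 1))"
      unfolding eq by (rule lowest_add_above(2)[OF 1 2]) auto
    moreover have "above (- int n - 1, - int n - 1) (var h ?k)"
      by (rule above_mono[OF lowest_above[OF conjunct1[OF Suc.IH]]]) auto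
    moreover have "int (Suc n) + 2 = ?k + 1" "int (Suc n) + 1 = ?k" "- int (Suc n) = - int n - 1" "1 - int (Suc n) = - int n" by auto
    ultimately show ?case by (simp only: simp_thms)
  qed
  then show ?thesis ..
qed

lemma lowest_var_down: "lowest (1 - int n, - int n) (var h (1 - int n))"
proof -
  have "lowest (1 - int n, - int n) (var h (1 - int n)) \<and> above (- int n, - int n) (var h (2 - int n))"
  proof (induction n)
    case 0
    have "above (0, 0) (var h 2)"
      unfolding var_2 by (rule above_mono[OF lowest_above[OF lowest_Xm]]) auto
    then show ?case by (simp add: var_1 lowest_Xm)
  next
    case (Suc n)
    let ?k = "1 - int n"
    have eq: "var h (?k - 1) = scl (qh 1) (var h ?k * delta_elt h)
      - (scl (qh 2) (var h (?k + 1)) + scl (qh 1 * h) 1)"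
      by (simp add: var_mult_delta scl_simps qh_mult mult_ac)
    have 1: "lowest (- int n, - int n - 1) (scl (qh 1) (var h ?k * delta_elt h))"
      using lowest_scl[OF lowest_mult[OF conjunct1[OF Suc.IH] lowest_delta[of h]], of "1"] by simp
    have 2: "above (- int n, - int n) (scl (qh 2) (var h (?k + 1)) + scl (qh 1 * h) 1)"
      using Suc.IH by (intro above_add above_scl above_mono[OF lowest_above[OF lowest_one]]) auto
    have "lowest (- int n, - int n - 1) (var h (?k - 1))"
      unfolding eq by (rule lowest_add_above(2)[OF 1 2]) auto
    moreover have "above (- int n - 1, - int n - 1) (var h ?k)"
      by (rule above_mono[OF lowest_above[OF conjunct1[OF Suc.IH]]]) auto
    moreover have "1 - int (Suc n) = ?k - 1" "2 - int (Suc n) = ?k" "- int (Suc n) = - int n - 1" "?k - 1 = - int n" by auto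
    ultimately show ?case by (simp only: simp_thms)
  qed
  then show ?thesis ..
qed

text \<open>The negative of the denominator vector of \<open>X_k\<close>.\<close>

definition low :: "int \<Rightarrow> int \<times> int" where
  "low k = (if k \<ge> 2 then (2 - k, 3 - k) else (k, k - 1))"

lemma lowest_var: "lowest (low k) (var h k)"
proof (cases "k \<ge> 2")
  case True
  then show ?thesis using lowest_var_up[of "nat (k - 2)" h] by (simp add: low_def)
next
  case False
  then show ?thesis using lowest_var_down[of "nat (1 - k)" h] by (simp add: low_def)
qed

lemma lowest_tbar: "lowest p x \<Longrightarrow> lowest p (tbar x)"
  unfolding lowest_def above_def lookup_tbar by (metis bar_0 bar_qh)

text \<open>Bar reverses products and preserves lowest exponents, which reduces this to left
  cancellation.\<close>

lemma lowest_right_regular: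
  assumes "lowest p x" "y * x = z * x"
  shows "y = z"
proof -
  have "tbar x * tbar y = tbar x * tbar z"
    using assms(2) by (metis tbar_mult)
  then have "tbar y = tbar z"
    by (rule lowest_left_regular[OF lowest_tbar[OF assms(1)]])
  then show ?thesis
    by (metis bar_bar lookup_tbar qtorus_eqI)
qed

text \<open>Each new variable is found by cancelling the opposite outer one, on the left going up
  and on the right going down. By induction the cancelled factor is common to both families, so it
  has a lowest exponent.\<close>

lemma cluster_family_unique:
  assumes X: "cluster_family h X" and Y: "cluster_family h Y" and low: "\<And>k. \<exists>p. lowest p (X k)"
  shows "Y = X"
proof
  fix k
  have EX: "X (k - 1) * X (k + 1) = scl (qh 2) (X k ^ 2) + scl (qh 1 * h) (X k) + 1" for k
    using X unfolding cluster_family_def by blast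
  have EY: "Y (k - 1) * Y (k + 1) = scl (qh 2) (Y k ^ 2) + scl (qh 1 * h) (Y k) + 1" for k
    using Y unfolding cluster_family_def by blast
  have "Y k = X k \<and> Y (k + 1) = X (k + 1)"
  proof (induction k rule: int_induct[where k = 1])
    case base then show ?case using X Y by (simp add: cluster_family_def)
  next
    case (step1 i)
    then have "X i * Y (i + 2) = X i * X (i + 2)"
      using EX[of "i + 1"] EY[of "i + 1"] by (simp add: add.commute)
    then have "Y (i + 2) = X (i + 2)" using low lowest_left_regular by blast
    then show ?case using step1 by (simp add: add.commute)
  next
    case (step2 i)
    then have "Y (i - 1) * X (i + 1) = X (i - 1) * X (i + 1)"
      using EX[of i] EY[of i] by simp
    then have "Y (i - 1) = X (i - 1)" using low lowest_right_regular by blast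
    then show ?case using step2 by simp
  qed
  then show "Y k = X k" ..
qed

text \<open>Existence by construction and uniqueness by cancellation evaluate the definite
  description in \<open>cluster_var\<close>.\<close>

lemma cluster_var_eq:
  assumes "bar h = h"
  shows "cluster_var h = var h"
proof -
  have F: "cluster_family h (var h)"
    unfolding cluster_family_def using var_exchange[OF assms] by (simp add: var_1 var_2)
  show ?thesis
    unfolding cluster_var_def
  proof (rule the_equality)
    show "cluster_family h (var h)" by (fact F)
  qed (metis F cluster_family_unique lowest_var)
qed

subsection \<open>Chebyshev polynomials\<close>

text \<open>Chebyshev polynomials of the second kind, normalised so that \<open>x = z + 1/z\<close>
  gives \<open>(z^{n+1} - z^{-n-1}) / (z - z^{-1})\<close>.\<close>

fun chebU :: "nat \<Rightarrow> 'a::ring_1 \<Rightarrow> 'a" where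
  "chebU 0 x = 1"
| "chebU (Suc 0) x = x"
| "chebU (Suc (Suc n)) x = chebU (Suc n) x * x - chebU n x"

text \<open>The value 2 at index 0 makes the three-term recursion and the product formula uniform.\<close>

definition chebT :: "nat \<Rightarrow> 'a::ring_1 \<Rightarrow> 'a" where
  "chebT n x = (if n = 0 then 2 else cheb n x)"

lemma chebT_0 [simp]: "chebT 0 x = 2" and chebT_1 [simp]: "chebT (Suc 0) x = x"
  by (simp_all add: chebT_def)

lemma chebT_Suc_Suc: "chebT (Suc (Suc n)) x = chebT (Suc n) x * x - chebT n x"
  by (cases n) (simp_all add: chebT_def power2_eq_square)

lemma cheb_eq_chebT: "n > 0 \<Longrightarrow> cheb n x = chebT n x"
  by (simp add: chebT_def)

lemma chebT_commute: "x * y = y * x \<Longrightarrow> chebT n x * y = y * chebT n x"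
proof (induction n rule: induct_nat_012)
  case (ge2 n)
  then show ?case
    by (simp add: chebT_Suc_Suc algebra_simps) (metis mult.assoc)
qed (simp_all add: mult_2 mult_2_right)

text \<open>At \<open>x = z + 1/z\<close> the polynomial is \<open>z^n + z^{-n}\<close>, and this is
  the product-to-sum rule.\<close>

lemma chebT_mult: "n \<le> m \<Longrightarrow> chebT m x * chebT n x = chebT (m + n) x + chebT (m - n) x"
proof (induction n rule: induct_nat_012)
  case 0
  then show ?case by (simp add: mult_2_right)
next
  case 1
  then show ?case by (cases m) (simp_all add: chebT_Suc_Suc)
next
  case (ge2 n)
  \<comment> \<open>\<open>j\<close> is the final difference of the indices; naming it removes
    truncated subtraction.\<close>
  obtain j where m: "m = Suc (Suc (n + j))" using ge2.prems by (metis add_Suc le_Suc_ex)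
  have "chebT m x * chebT (Suc (Suc n)) x = chebT m x * chebT (Suc n) x * x - chebT m x * chebT n x"
    by (simp add: chebT_Suc_Suc algebra_simps)
  also have "\<dots> = (chebT (Suc (m + n)) x + chebT (Suc j) x) * x - (chebT (m + n) x + chebT (Suc (Suc j)) x)"
    using ge2.IH m by simp
  also have "\<dots> = chebT (m + Suc (Suc n)) x + chebT (m - Suc (Suc n)) x"
    by (simp add: m chebT_Suc_Suc algebra_simps)
  finally show ?case .
qed

text \<open>Iterated, this writes the second kind through the first kind without subtraction, as
  positivity in \<open>chebU_in\<close> requires.\<close>

lemma chebU_eq: "chebU (Suc (Suc n)) x = chebT (Suc (Suc n)) x + chebU n x"
proof (induction n rule: induct_nat_012)
  case (ge2 n)
  have "chebU (Suc (Suc (Suc (Suc n)))) x = chebU (Suc (Suc (Suc n))) x * x - chebU (Suc (Suc n)) x"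
    by (rule chebU.simps)
  also have "\<dots> = (chebT (Suc (Suc (Suc n))) x + chebU (Suc n) x) * x - (chebT (Suc (Suc n)) x + chebU n x)"
    unfolding ge2.IH ..
  finally show ?case by (simp add: chebT_Suc_Suc[of "Suc (Suc n)"] algebra_simps)
qed (simp_all add: chebT_Suc_Suc algebra_simps, simp only: mult_2)

text \<open>The solution of the Chebyshev recursion driven by source terms \<open>c\<close>,
  starting from 0 and \<open>c 0\<close>; see \<open>cheb_conv_Suc_Suc\<close>.\<close>

definition cheb_conv :: "(nat \<Rightarrow> laurent) \<Rightarrow> nat \<Rightarrow> qtorus \<Rightarrow> qtorus" where
  "cheb_conv c n x = (\<Sum>i<n. scl (c i) (chebU (n - Suc i) x))"

lemma sum_scl_mult: "(\<Sum>i\<in>A. scl (c i) (f i)) * x = (\<Sum>i\<in>A. scl (c i) (f i * x))"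
  by (simp add: sum_distrib_right scl_mult)

lemma cheb_conv_Suc_Suc:
  "cheb_conv c (Suc (Suc n)) x = cheb_conv c (Suc n) x * x - cheb_conv c n x + scl (c (Suc n)) 1"
proof -
  have "cheb_conv c (Suc n) x * x = (\<Sum>i<n. scl (c i) (chebU (n - i) x * x)) + scl (c n) x"
    by (simp add: cheb_conv_def distrib_right sum_scl_mult scl_mult)
  also have "(\<Sum>i<n. scl (c i) (chebU (n - i) x * x))
    = (\<Sum>i<n. scl (c i) (chebU (Suc (n - i)) x) + scl (c i) (chebU (n - Suc i) x))"
  proof (intro sum.cong refl)
    fix i assume "i \<in> {..<n}"
    then obtain j where "n - i = Suc j" "n - Suc i = j" by (metis Suc_diff_Suc lessThan_iff)
    then show "scl (c i) (chebU (n - i) x * x)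
      = scl (c i) (chebU (Suc (n - i)) x) + scl (c i) (chebU (n - Suc i) x)"
      by (simp add: qt.scale_right_diff_distrib)
  qed
  also have "\<dots> = (\<Sum>i<n. scl (c i) (chebU (Suc n - i) x)) + cheb_conv c n x"
    by (simp add: sum.distrib cheb_conv_def Suc_diff_le)
  finally show ?thesis
    by (simp add: cheb_conv_def)
qed

lemma cheb_conv_0 [simp]: "cheb_conv c 0 x = 0" and cheb_conv_1: "cheb_conv c (Suc 0) x = scl (c 0) 1"
  by (simp_all add: cheb_conv_def)

subsection \<open>Product formulas\<close>

text \<open>The two powers come from the constants \<open>h\<close> that appear when the outer
  variables \<open>X_{k+i}\<close> and \<open>X_{k-i}\<close> are multiplied by delta. At
  \<open>i = 0\<close> these coincide and contribute only once.\<close>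

definition var_cheb_coeff :: "nat \<Rightarrow> laurent" where
  "var_cheb_coeff i = (if i = 0 then 1 else qh (int i) + qh (- int i))"

text \<open>Along the Chebyshev recursion, the inner variables produced by delta cancel against the
  subtracted term, and the leftover constants drive \<open>cheb_conv\<close>.\<close>

lemma var_mult_chebT:
  "var h k * chebT n (delta_elt h) =
     scl (qh (- int n)) (var h (k - int n)) + scl (qh (int n)) (var h (k + int n))
     + scl h (cheb_conv var_cheb_coeff n (delta_elt h))"
proof (induction n rule: induct_nat_012)
  case 0
  then show ?case by (simp add: mult_2_right)
next
  case 1
  then show ?case by (simp add: var_mult_delta cheb_conv_1 var_cheb_coeff_def)
next
  case (ge2 n)
  have "var h k * chebT (Suc (Suc n)) (delta_elt h)
    = var h k * chebT (Suc n) (delta_elt h) * delta_elt h - var h k * chebT n (delta_elt h)"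
    by (simp add: chebT_Suc_Suc algebra_simps)
  also have "\<dots> = scl (qh (- 1 - int n)) (var h (k - (1 + int n)) * delta_elt h)
     + scl (qh (1 + int n)) (var h (k + (1 + int n)) * delta_elt h)
     + scl h (cheb_conv var_cheb_coeff (Suc n) (delta_elt h) * delta_elt h)
     - (scl (qh (- int n)) (var h (k - int n)) + scl (qh (int n)) (var h (k + int n))
     + scl h (cheb_conv var_cheb_coeff n (delta_elt h)))"
    unfolding ge2.IH by (simp add: scl_simps diff_diff_eq add_ac)
  also have "\<dots> = scl (qh (- 2 - int n)) (var h (k - (2 + int n))) + scl (qh (2 + int n)) (var h (k + (2 + int n)))
     + scl h (cheb_conv var_cheb_coeff (Suc (Suc n)) (delta_elt h))"
    unfolding var_mult_delta cheb_conv_Suc_Suc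
    by (simp add: scl_simps qh_mult var_cheb_coeff_def mult_ac)
      (simp add: algebra_simps)
  finally have "var h k * chebT (Suc (Suc n)) (delta_elt h) = scl (qh (- 2 - int n)) (var h (k - (2 + int n))) + scl (qh (2 + int n)) (var h (k + (2 + int n)))
     + scl h (cheb_conv var_cheb_coeff (Suc (Suc n)) (delta_elt h))" .
  moreover have "- int (Suc (Suc n)) = - 2 - int n" "int (Suc (Suc n)) = 2 + int n"
    by simp_all
  ultimately show ?case by (simp only:)
qed

text \<open>The linear recursion applied to each summand, with boundary corrections so that every
  sum again starts at \<open>k + 1\<close>, as in \<open>var_var_rest\<close>.\<close>

lemma sum_var_mult_delta:
  "(\<Sum>i<Suc n. var h (k + 1 + int i)) * delta_elt h =
     scl (qh (-1)) (var h k + (\<Sum>i<n. var h (k + 1 + int i)))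
     + scl (qh 1) ((\<Sum>i<Suc (Suc n). var h (k + 1 + int i)) - var h (k + 1)) + scl (of_nat (Suc n) * h) 1"
proof (induction n)
  case 0
  show ?case by (simp add: var_mult_delta add.commute)
next
  case (Suc n)
  have "var h (k + 1 + int (Suc n)) * delta_elt h
    = scl (qh (-1)) (var h (k + 1 + int n)) + scl (qh 1) (var h (k + 1 + int (Suc (Suc n)))) + scl h 1"
    by (simp add: var_mult_delta) (simp add: algebra_simps)
  then show ?case using Suc
    by (simp add: scl_simps del: of_nat_Suc) (simp add: scl_simps algebra_simps, simp only: mult_2_right qt.scale_left_distrib)
qed

text \<open>The factor \<open>i + 1\<close> counts the constants produced when \<open>i + 1\<close>
  consecutive variables are multiplied by delta. The power of \<open>q\<close> undoes the prefactor
  \<open>qh (- 2 - int n)\<close> of \<open>var_var_rest\<close> at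
  \<open>n = i + 1\<close>.\<close>

definition var_var_coeff :: "nat \<Rightarrow> laurent" where
  "var_var_coeff i = of_nat (Suc i) * qh (int i + 3)"

definition var_var_rest :: "laurent \<Rightarrow> int \<Rightarrow> nat \<Rightarrow> qtorus" where
  "var_var_rest h k n = scl (qh (- int n)) (chebU n (delta_elt h))
     + scl (qh 1 * h) (\<Sum>i<Suc n. var h (k + 1 + int i))
     + scl (qh (- 2 - int n) * h * h) (cheb_conv var_var_coeff n (delta_elt h))"

lemma var_var_rest_Suc_Suc:
  "var_var_rest h k (Suc (Suc n)) = scl (qh (-1)) (var_var_rest h k (Suc n) * delta_elt h)
     - scl (qh (-2)) (var_var_rest h k n) - scl (qh (-1) * h) (var h k) + scl (qh 1 * h) (var h (k + 1))"
proof -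
  let ?S = "\<lambda>n. (\<Sum>i<n. var h (k + 1 + int i))"
  have 1: "chebU (Suc n) (delta_elt h) * delta_elt h = chebU (Suc (Suc n)) (delta_elt h) + chebU n (delta_elt h)"
    by simp
  have 2: "cheb_conv var_var_coeff (Suc n) (delta_elt h) * delta_elt h =
    cheb_conv var_var_coeff (Suc (Suc n)) (delta_elt h) + cheb_conv var_var_coeff n (delta_elt h)
    - scl (var_var_coeff (Suc n)) 1"
    by (simp add: cheb_conv_Suc_Suc)
  show ?thesis
    unfolding var_var_rest_def distrib_right scl_mult 1 2 sum_var_mult_delta
    by (simp add: scl_simps qh_mult var_var_coeff_def del: sum.lessThan_Suc chebU.simps)
      (simp add: mult_ac qh_mult algebra_simps del: sum.lessThan_Suc chebU.simps)
qed

text \<open>For fixed \<open>k\<close> the defect \<open>D\<close> obeys the inhomogeneous recursion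
  of \<open>var_var_rest_Suc_Suc\<close> in the gap. Commutation gives \<open>D 1 = 0\<close> and
  exchange gives \<open>D 2\<close>, which fix all later values.\<close>

lemma var_mult_var:
  assumes h: "bar h = h"
  shows "var h k * var h (k + int n + 2) =
     scl (qh 2) (var h (k + 1) * var h (k + int n + 1)) + var_var_rest h k n"
proof -
  let ?d = "delta_elt h"
  define D where "D j = var h k * var h (k + j) - scl (qh 2) (var h (k + 1) * var h (k + j - 1))" for j
  \<comment> \<open>The last two terms are the constants \<open>h\<close> of the linear recursion,
    multiplied by the left factors of the two products.\<close>
  have rec: "D (j + 1) = scl (qh (-1)) (D j * ?d) - scl (qh (-2)) (D (j - 1)) - scl (qh (-1) * h) (var h k)
     + scl (qh 1 * h) (var h (k + 1))" for j
  proof -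
    have next_var: "y * var h (i + 1) = scl (qh (-1)) (y * var h i * ?d) - scl (qh (-2)) (y * var h (i - 1)) - scl (qh (-1) * h) y"
      for y i
      by (simp add: mult.assoc var_mult_delta scl_simps qh_mult mult_ac)
    show ?thesis
      using next_var[of "var h k" "k + j"] next_var[of "var h (k + 1)" "k + j - 1"]
      by (simp add: D_def scl_simps qh_mult add.assoc diff_diff_eq) (simp add: algebra_simps)
  qed
  have D1: "D 1 = 0" by (simp add: D_def var_commute)
  have D2: "D 2 = scl (qh 1 * h) (var h (k + 1)) + 1"
    using var_exchange[OF h, of "k + 1"] by (simp add: D_def power2_eq_square add.commute)
  have "D (int n + 2) = var_var_rest h k n"
  proof (induction n rule: induct_nat_012)
    case 0
    then show ?case by (simp add: D2 var_var_rest_def add.commute)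
  next
    case 1
    show ?case using rec[of 2]
      by (simp add: D1 D2 var_var_rest_def cheb_conv_1 var_var_coeff_def var_mult_delta scl_simps qh_mult mult_ac)
  next
    case (ge2 n)
    have "D (int (Suc (Suc n)) + 2) = D (int (Suc n) + 2 + 1)" "D (int (Suc n) + 2 - 1) = D (int n + 2)"
      by (simp_all add: algebra_simps)
    then show ?case using ge2.IH rec[of "int (Suc n) + 2"] by (simp only: var_var_rest_Suc_Suc)
  qed
  then show ?thesis
    by (simp add: D_def algebra_simps)
qed

subsection \<open>Non-negative combinations\<close>

lemma nonneg_poly_monom: "of_nat n * qh 1 ^ i * qh (-1) ^ j * h ^ k \<in> nonneg_poly h"
  unfolding nonneg_poly_def
  by (rule CollectI, rule exI[of _ "{(i, j, k)}"], rule exI[of _ "\<lambda>_ _ _. n"]) simp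

lemma nonneg_poly_0: "0 \<in> nonneg_poly h"
  using nonneg_poly_monom[of 0] by simp

lemma nonneg_poly_add:
  assumes "x \<in> nonneg_poly h" "y \<in> nonneg_poly h"
  shows "x + y \<in> nonneg_poly h"
proof -
  let ?m = "\<lambda>i j k. qh 1 ^ i * qh (-1) ^ j * h ^ k"
  obtain S c where x: "finite S" "x = (\<Sum>(i, j, k)\<in>S. of_nat (c i j k) * qh 1 ^ i * qh (-1) ^ j * h ^ k)"
    using assms(1) unfolding nonneg_poly_def by blast
  obtain T d where y: "finite T" "y = (\<Sum>(i, j, k)\<in>T. of_nat (d i j k) * qh 1 ^ i * qh (-1) ^ j * h ^ k)"
    using assms(2) unfolding nonneg_poly_def by blast
  define e where "e i j k = (if (i, j, k) \<in> S then c i j k else 0) + (if (i, j, k) \<in> T then d i j k else 0)" for i j k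
  have "x = (\<Sum>(i, j, k)\<in>S \<union> T. of_nat (if (i, j, k) \<in> S then c i j k else 0) * ?m i j k)"
    unfolding x(2) using x(1) y(1)
    by (intro sum.mono_neutral_cong_left) (auto simp: mult.assoc)
  moreover have "y = (\<Sum>(i, j, k)\<in>S \<union> T. of_nat (if (i, j, k) \<in> T then d i j k else 0) * ?m i j k)"
    unfolding y(2) using x(1) y(1)
    by (intro sum.mono_neutral_cong_left) (auto simp: mult.assoc)
  ultimately have "x + y = (\<Sum>(i, j, k)\<in>S \<union> T. of_nat (e i j k) * qh 1 ^ i * qh (-1) ^ j * h ^ k)"
    by (auto simp: e_def sum.distrib[symmetric] distrib_right mult.assoc intro!: sum.cong)
  then show ?thesis
    unfolding nonneg_poly_def using x(1) y(1) by blast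
qed

lemma nonneg_poly_sum: "(\<And>i. i \<in> A \<Longrightarrow> f i \<in> nonneg_poly h) \<Longrightarrow> sum f A \<in> nonneg_poly h"
  by (induction A rule: infinite_finite_induct) (auto simp: nonneg_poly_0 nonneg_poly_add)

lemma nonneg_poly_mult:
  assumes "x \<in> nonneg_poly h" "y \<in> nonneg_poly h"
  shows "x * y \<in> nonneg_poly h"
proof -
  obtain S c where x: "finite S" "x = (\<Sum>(i, j, k)\<in>S. of_nat (c i j k) * qh 1 ^ i * qh (-1) ^ j * h ^ k)"
    using assms(1) unfolding nonneg_poly_def by blast
  obtain T d where y: "finite T" "y = (\<Sum>(i, j, k)\<in>T. of_nat (d i j k) * qh 1 ^ i * qh (-1) ^ j * h ^ k)"
    using assms(2) unfolding nonneg_poly_def by blast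
  have "(of_nat (c i j k) * qh 1 ^ i * qh (-1) ^ j * h ^ k) * (of_nat (d i' j' k') * qh 1 ^ i' * qh (-1) ^ j' * h ^ k')
    \<in> nonneg_poly h" for i j k i' j' k'
    using nonneg_poly_monom[of "c i j k * d i' j' k'" "i + i'" "j + j'" h "k + k'"]
    by (simp add: power_add mult_ac)
  then show ?thesis
    unfolding x(2) y(2) sum_product by (intro nonneg_poly_sum) (auto split: prod.splits)
qed

lemma nonneg_poly_h: "h \<in> nonneg_poly h"
  using nonneg_poly_monom[of 1 0 0 h 1] by simp

lemma nonneg_poly_of_nat: "of_nat n \<in> nonneg_poly h"
  using nonneg_poly_monom[of n 0 0 h 0] by simp

lemma nonneg_poly_1: "1 \<in> nonneg_poly h"
  using nonneg_poly_of_nat[of 1] by simp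

lemma nonneg_poly_qh: "qh r \<in> nonneg_poly h"
proof -
  have p: "qh a ^ n = qh (int n * a)" for a n
    by (induction n) (simp_all add: qh_mult algebra_simps)
  show ?thesis
  proof (cases "r \<ge> 0")
    case True
    then show ?thesis using nonneg_poly_monom[of 1 "nat r" 0 h 0] by (simp add: p)
  next
    case False
    then show ?thesis using nonneg_poly_monom[of 1 0 "nat (- r)" h 0] by (simp add: p)
  qed
qed

lemmas nonneg_poly_intros = nonneg_poly_0 nonneg_poly_1 nonneg_poly_add nonneg_poly_mult
  nonneg_poly_sum nonneg_poly_h nonneg_poly_of_nat nonneg_poly_qh

text \<open>Inductive, so that closure properties follow by rule induction;
  \<open>pos_span_explicit\<close> recovers the sum over distinct elements.\<close>

inductive_set pos_span :: "laurent \<Rightarrow> qtorus set \<Rightarrow> qtorus set" for h B where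
  zero: "0 \<in> pos_span h B"
| step: "x \<in> pos_span h B \<Longrightarrow> b \<in> B \<Longrightarrow> c \<in> nonneg_poly h \<Longrightarrow> scl c b + x \<in> pos_span h B"

lemma pos_span_add: "x \<in> pos_span h B \<Longrightarrow> y \<in> pos_span h B \<Longrightarrow> x + y \<in> pos_span h B"
  by (induction rule: pos_span.induct) (auto simp: add.assoc intro: pos_span.intros)

lemma pos_span_scl: "x \<in> pos_span h B \<Longrightarrow> c \<in> nonneg_poly h \<Longrightarrow> scl c x \<in> pos_span h B"
  by (induction rule: pos_span.induct)
    (auto simp: qt.scale_right_distrib intro: pos_span.intros nonneg_poly_mult)

lemma pos_span_base: "b \<in> B \<Longrightarrow> b \<in> pos_span h B"
  using pos_span.step[OF pos_span.zero _ nonneg_poly_1, of b B h] by simp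

lemma pos_span_sum: "(\<And>i. i \<in> A \<Longrightarrow> f i \<in> pos_span h B) \<Longrightarrow> sum f A \<in> pos_span h B"
  by (induction A rule: infinite_finite_induct) (auto simp: pos_span.zero pos_span_add)

lemma pos_span_span: "x \<in> pos_span h B \<Longrightarrow> x \<in> qt.span B"
  by (induction rule: pos_span.induct) (auto intro: qt.span_add qt.span_scale qt.span_base qt.span_zero)

lemma pos_span_explicit:
  assumes "x \<in> pos_span h B"
  shows "\<exists>S c. finite S \<and> S \<subseteq> B \<and> (\<forall>y\<in>S. c y \<in> nonneg_poly h) \<and> x = (\<Sum>y\<in>S. scl (c y) y)"
  using assms
proof (induction rule: pos_span.induct)
  case zero
  show ?case by (rule exI[of _ "{}"]) auto
next
  case (step x b c0)
  then obtain S c where S: "finite S" "S \<subseteq> B" "\<forall>y\<in>S. c y \<in> nonneg_poly h" "x = (\<Sum>y\<in>S. scl (c y) y)"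
    by blast
  \<comment> \<open>\<open>b\<close> may already lie in \<open>S\<close>; its two coefficients then
    add up.\<close>
  define c' where "c' y = (if y \<in> S then c y else 0) + (if y = b then c0 else 0)" for y
  have "x = (\<Sum>y\<in>insert b S. scl (if y \<in> S then c y else 0) y)"
    unfolding S(4) by (rule sum.mono_neutral_cong_left) (use S(1) in auto)
  moreover have "scl c0 b = (\<Sum>y\<in>insert b S. scl (if y = b then c0 else 0) y)"
  proof -
    have "(\<Sum>y\<in>{b}. scl c0 y) = (\<Sum>y\<in>insert b S. scl (if y = b then c0 else 0) y)"
      by (rule sum.mono_neutral_cong_left) (use S(1) in auto)
    then show ?thesis by simp
  qed
  ultimately have "scl c0 b + x = (\<Sum>y\<in>insert b S. scl (c' y) y)"
    by (simp only: c'_def qt.scale_left_distrib sum.distrib add.commute)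
  moreover have "\<forall>y\<in>insert b S. c' y \<in> nonneg_poly h"
    using S(3) step.hyps(3) by (auto simp: c'_def intro!: nonneg_poly_intros)
  ultimately show ?case
    using S(1,2) step.hyps(2) by (metis finite_insert insert_subset)
qed

subsection \<open>Words in the cluster variables\<close>

lemma chebT_one_commute: "x * chebT n x = chebT n x * x"
  by (rule chebT_commute[symmetric]) simp

lemma chebU_commute: "x * chebU n x = chebU n x * x"
proof (induction n rule: induct_nat_012)
  case (ge2 n)
  then show ?case by (simp add: algebra_simps) (metis mult.assoc)
qed simp_all

lemma tbar_two: "tbar 2 = 2"
  by (metis one_add_one tbar_1 tbar_add)

lemma tbar_chebT: "tbar (chebT n x) = chebT n (tbar x)"
proof (induction n rule: induct_nat_012)
  case (ge2 n)
  then show ?case by (simp add: chebT_Suc_Suc tbar_diff tbar_mult chebT_one_commute)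
qed (simp_all add: tbar_two)

lemma tbar_chebU: "tbar (chebU n x) = chebU n (tbar x)"
proof (induction n rule: induct_nat_012)
  case (ge2 n)
  then show ?case by (simp add: tbar_diff tbar_mult chebU_commute)
qed simp_all

lemma tbar_sum: "tbar (\<Sum>i\<in>A. f i) = (\<Sum>i\<in>A. tbar (f i))"
  by (induction A rule: infinite_finite_induct) (simp_all add: tbar_add)

lemma tbar_cheb_conv: "tbar (cheb_conv c n x) = cheb_conv (\<lambda>i. bar (c i)) n (tbar x)"
  by (simp add: cheb_conv_def tbar_sum tbar_scl tbar_chebU)

lemma bar_of_nat [simp]: "bar (of_nat n) = of_nat n"
  by (induction n) (simp_all add: bar_add)

definition word :: "laurent \<Rightarrow> int list \<Rightarrow> qtorus" where
  "word h ks = prod_list (map (var h) ks)"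

lemma word_simps [simp]:
  "word h [] = 1" "word h (k # ks) = var h k * word h ks" "word h (us @ vs) = word h us * word h vs"
  by (simp_all add: word_def)

text \<open>Contains 1 in place of \<open>chebT 0\<close>, which is 2 and enters as
  \<open>1 + 1\<close>.\<close>

definition cheb_gens :: "laurent \<Rightarrow> qtorus set" where
  "cheb_gens h = insert 1 {chebT n (delta_elt h) | n. n > 0}"

lemma chebT_in: "cheb_gens h \<subseteq> B \<Longrightarrow> chebT n (delta_elt h) \<in> pos_span h B"
proof (cases "n = 0")
  case True
  assume "cheb_gens h \<subseteq> B"
  then have "1 + 1 \<in> pos_span h B"
    by (intro pos_span_add pos_span_base) (auto simp: cheb_gens_def)
  then show ?thesis by (simp add: True)
qed (auto simp: cheb_gens_def intro: pos_span_base)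

lemma chebU_in: "cheb_gens h \<subseteq> B \<Longrightarrow> chebU n (delta_elt h) \<in> pos_span h B"
proof (induction n rule: induct_nat_012)
  case 0
  then show ?case by (auto simp: cheb_gens_def intro: pos_span_base)
next
  case 1
  then show ?case using chebT_in[of h B 1] by simp
next
  case (ge2 n)
  then show ?case using chebT_in[of h B "Suc (Suc n)"] by (simp only: chebU_eq pos_span_add)
qed

lemma cheb_conv_in:
  "cheb_gens h \<subseteq> B \<Longrightarrow> (\<And>i. c i \<in> nonneg_poly h) \<Longrightarrow> cheb_conv c n (delta_elt h) \<in> pos_span h B"
  unfolding cheb_conv_def by (intro pos_span_sum pos_span_scl chebU_in)

abbreviation gens :: "laurent \<Rightarrow> qtorus set" where
  "gens h \<equiv> cheb_gens h \<union> range (var h)"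

lemma var_in: "var h k \<in> pos_span h (gens h)"
  by (intro pos_span_base) auto

lemma var_cheb_coeff_nonneg: "var_cheb_coeff i \<in> nonneg_poly h"
  by (auto simp: var_cheb_coeff_def intro!: nonneg_poly_intros)

lemma var_mult_chebT_in: "var h k * chebT n (delta_elt h) \<in> pos_span h (gens h)"
  unfolding var_mult_chebT
  by (intro pos_span_add pos_span_scl cheb_conv_in var_in nonneg_poly_intros var_cheb_coeff_nonneg) auto

text \<open>The bar image of \<open>var_mult_chebT\<close>: the two outer powers of \<open>q\<close>
  are exchanged and the other coefficients are invariant.\<close>

lemma chebT_mult_var_in:
  assumes h: "bar h = h"
  shows "chebT n (delta_elt h) * var h k \<in> pos_span h (gens h)"
proof -
  have c: "bar (var_cheb_coeff i) = var_cheb_coeff i" for i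
    by (simp add: var_cheb_coeff_def bar_add add.commute)
  have "chebT n (delta_elt h) * var h k = tbar (var h k * chebT n (delta_elt h))"
    by (simp add: tbar_mult tbar_chebT tbar_delta tbar_var h)
  also have "\<dots> = scl (qh (int n)) (var h (k - int n)) + scl (qh (- int n)) (var h (k + int n))
     + scl h (cheb_conv var_cheb_coeff n (delta_elt h))"
    unfolding var_mult_chebT
    by (simp add: tbar_add tbar_scl tbar_cheb_conv c tbar_delta tbar_var h)
  also have "\<dots> \<in> pos_span h (gens h)"
    by (intro pos_span_add pos_span_scl cheb_conv_in var_in nonneg_poly_intros var_cheb_coeff_nonneg) auto
  finally show ?thesis .
qed

text \<open>The bar image is the remainder for two variables in decreasing order.\<close>

lemma var_var_rest_in:
  assumes h: "bar h = h"
  shows "var_var_rest h k n \<in> pos_span h (gens h)" "tbar (var_var_rest h k n) \<in> pos_span h (gens h)"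
proof -
  have 1: "var_var_coeff i \<in> nonneg_poly h" for i
    unfolding var_var_coeff_def by (intro nonneg_poly_intros)
  have 2: "bar (var_var_coeff i) \<in> nonneg_poly h" for i
    unfolding var_var_coeff_def bar_mult bar_of_nat bar_qh by (intro nonneg_poly_intros)
  show "var_var_rest h k n \<in> pos_span h (gens h)"
    unfolding var_var_rest_def
    by (intro pos_span_add pos_span_scl pos_span_sum cheb_conv_in chebU_in var_in nonneg_poly_intros 1) auto
  show "tbar (var_var_rest h k n) \<in> pos_span h (gens h)"
    unfolding var_var_rest_def tbar_add tbar_scl tbar_sum tbar_chebU tbar_cheb_conv
      tbar_delta[OF h] tbar_var[OF h] bar_mult bar_qh h
    by (intro pos_span_add pos_span_scl pos_span_sum cheb_conv_in chebU_in var_in nonneg_poly_intros 2) auto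
qed

text \<open>By linearity, a factor expanded in \<open>gens\<close> can be treated generator by
  generator inside a word.\<close>

lemma sandwich:
  assumes "x \<in> pos_span h (gens h)"
    and "\<And>g. g \<in> cheb_gens h \<Longrightarrow> word h u * g * word h v \<in> pos_span h B"
    and "\<And>k. word h (u @ [k] @ v) \<in> pos_span h B"
  shows "word h u * x * word h v \<in> pos_span h B"
  using assms(1)
proof (induction rule: pos_span.induct)
  case zero
  show ?case by (simp add: pos_span.zero)
next
  case (step x b c)
  have "word h u * b * word h v \<in> pos_span h B"
    using step.hyps(2) assms(2) assms(3) by (auto simp: mult.assoc)
  then show ?case
    using step by (simp add: distrib_left distrib_right scl_mult pos_span_add pos_span_scl)
qed

text \<open>Moving a Chebyshev element past a cluster variable removes one of the two.\<close>

lemma word_cheb_word: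
  assumes h: "bar h = h" and B: "cheb_gens h \<subseteq> B"
    and short: "\<And>ks. length ks < r \<Longrightarrow> word h ks \<in> pos_span h B"
  shows "length u + length v < r \<Longrightarrow> g \<in> cheb_gens h \<Longrightarrow> word h u * g * word h v \<in> pos_span h B"
proof (induction "length u + length v" arbitrary: u v g rule: less_induct)
  case less
  show ?case
  proof (cases "g = 1")
    case True
    then show ?thesis using short[of "u @ v"] less.prems by simp
  next
    case False
    then obtain n where g: "g = chebT n (delta_elt h)" using less.prems by (auto simp: cheb_gens_def)
    show ?thesis
    proof (cases u rule: rev_cases)
      case (snoc u' k)
      have "word h u' * (var h k * g) * word h v \<in> pos_span h B"
        unfolding g
        by (rule sandwich[OF var_mult_chebT_in]) (use less snoc short[of "u' @ _ # v"] in auto)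
      then show ?thesis by (simp add: snoc mult.assoc)
    next
      case u: Nil
      show ?thesis
      proof (cases v)
        case Nil
        then show ?thesis using u B less.prems by (auto intro: pos_span_base)
      next
        \<comment> \<open>With nothing on its left, the Chebyshev element absorbs the first letter
          on its right.\<close>
        case (Cons k v')
        have "word h [] * (g * var h k) * word h v' \<in> pos_span h B"
          unfolding g
          by (rule sandwich[OF chebT_mult_var_in[OF h]])
            (use less.hyps[of "[]" v'] less.prems u Cons short[of "_ # v'"] in auto)
        then show ?thesis by (simp add: u Cons mult.assoc)
      qed
    qed
  qed
qed

text \<open>The product formula inside a word. Its remainder replaces two letters by a single letter
  or a Chebyshev element, so \<open>short\<close> and \<open>word_cheb_word\<close> cover
  it.\<close>

lemma word_reduce:
  assumes h: "bar h = h" and B: "cheb_gens h \<subseteq> B"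
    and short: "\<And>ks. length ks < length u + length v + 2 \<Longrightarrow> word h ks \<in> pos_span h B"
  shows "word h (u @ [k + 1, k + int n + 1] @ v) \<in> pos_span h B
      \<Longrightarrow> word h (u @ [k, k + int n + 2] @ v) \<in> pos_span h B"
    and "word h (u @ [k + int n + 1, k + 1] @ v) \<in> pos_span h B
      \<Longrightarrow> word h (u @ [k + int n + 2, k] @ v) \<in> pos_span h B"
proof -
  have rest: "word h u * x * word h v \<in> pos_span h B" if "x \<in> pos_span h (gens h)" for x
    using that by (rule sandwich) (use word_cheb_word[OF h B short] short[of "u @ _ # v"] in auto)
  have 1: "word h (u @ [k, k + int n + 2] @ v)
    = scl (qh 2) (word h (u @ [k + 1, k + int n + 1] @ v)) + word h u * var_var_rest h k n * word h v"
    using arg_cong[OF var_mult_var[OF h, of k n], of "\<lambda>x. word h u * x * word h v"]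
    by (simp add: mult.assoc scl_simps)
  show "word h (u @ [k, k + int n + 2] @ v) \<in> pos_span h B"
    if "word h (u @ [k + 1, k + int n + 1] @ v) \<in> pos_span h B"
    unfolding 1 by (intro pos_span_add pos_span_scl that nonneg_poly_qh rest var_var_rest_in h)
  have "var h (k + int n + 2) * var h k
     = scl (qh (-2)) (var h (k + int n + 1) * var h (k + 1)) + tbar (var_var_rest h k n)"
    using arg_cong[OF var_mult_var[OF h, of k n], of tbar]
    by (simp add: tbar_mult tbar_var h tbar_add tbar_scl)
  from arg_cong[OF this, of "\<lambda>x. word h u * x * word h v"]
  have 2: "word h (u @ [k + int n + 2, k] @ v)
    = scl (qh (-2)) (word h (u @ [k + int n + 1, k + 1] @ v)) + word h u * tbar (var_var_rest h k n) * word h v"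
    by (simp add: mult.assoc scl_simps)
  show "word h (u @ [k + int n + 2, k] @ v) \<in> pos_span h B"
    if "word h (u @ [k + int n + 1, k + 1] @ v) \<in> pos_span h B"
    unfolding 2 by (intro pos_span_add pos_span_scl that nonneg_poly_qh rest var_var_rest_in h)
qed

lemma near_commute:
  assumes "\<bar>k - l\<bar> \<le> 1"
  shows "\<exists>c. var h k * var h l = scl (qh c) (var h l * var h k)"
proof -
  consider "l = k" | "l = k + 1" | "k = l + 1" using assms by linarith
  then show ?thesis
  proof cases
    case 1
    then show ?thesis by (intro exI[of _ 0]) simp
  next
    case 2
    then show ?thesis using var_commute[of h k] by blast
  next
    case 3
    then show ?thesis using var_commute[of h l] by (intro exI[of _ "-2"]) (simp add: qh_mult)
  qed
qed

text \<open>The termination measure: replacing \<open>k\<close>, \<open>k + n + 2\<close> by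
  \<open>k + 1\<close>, \<open>k + n + 1\<close> lowers it by \<open>2 * (n + 1)\<close>.\<close>

definition sqs :: "int list \<Rightarrow> int" where
  "sqs ks = (\<Sum>k\<leftarrow>ks. k * k)"

lemma sqs_simps [simp]: "sqs [] = 0" "sqs (k # ks) = k * k + sqs ks" "sqs (us @ vs) = sqs us + sqs vs"
  by (simp_all add: sqs_def)

lemma sqs_nonneg: "sqs ks \<ge> 0"
  by (induction ks) auto

lemma word_adjacent_gap:
  assumes h: "bar h = h" and B: "cheb_gens h \<subseteq> B"
    and short: "\<And>ks. length ks < r \<Longrightarrow> word h ks \<in> pos_span h B"
    and small: "\<And>ks. length ks = r \<Longrightarrow> sqs ks < s \<Longrightarrow> word h ks \<in> pos_span h B"
    and u: "length (u @ [k, l] @ v) = r" "sqs (u @ [k, l] @ v) = s" "\<bar>k - l\<bar> \<ge> 2"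
  shows "word h (u @ [k, l] @ v) \<in> pos_span h B"
proof -
  have sh: "\<And>ks. length ks < length u + length v + 2 \<Longrightarrow> word h ks \<in> pos_span h B"
    using short u(1) by simp
  show ?thesis
  proof (cases "k < l")
    case True
    define n where "n = nat (l - k - 2)"
    have l: "l = k + int n + 2" using True u(3) by (simp add: n_def)
    have "word h (u @ [k + 1, k + int n + 1] @ v) \<in> pos_span h B"
      by (rule small) (use u in \<open>auto simp: l algebra_simps\<close>)
    from word_reduce(1)[OF h B sh this] show ?thesis by (simp add: l)
  next
    case False
    define n where "n = nat (k - l - 2)"
    have k: "k = l + int n + 2" using False u(3) by (simp add: n_def)
    have "word h (u @ [l + int n + 1, l + 1] @ v) \<in> pos_span h B"
      by (rule small) (use u in \<open>auto simp: k algebra_simps\<close>)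
    from word_reduce(2)[OF h B sh this] show ?thesis by (simp add: k)
  qed
qed

text \<open>The letter \<open>k\<close> travels right through letters at distance at most 1,
  commuting with them up to a power of \<open>q^{1/2}\<close>; such swaps keep the length and
  \<open>sqs\<close>. At the first letter at distance at least 2, \<open>word_adjacent_gap\<close>
  applies.\<close>

lemma word_gap:
  assumes h: "bar h = h" and B: "cheb_gens h \<subseteq> B"
    and short: "\<And>ks. length ks < r \<Longrightarrow> word h ks \<in> pos_span h B"
    and small: "\<And>ks. length ks = r \<Longrightarrow> sqs ks < s \<Longrightarrow> word h ks \<in> pos_span h B"
  shows "length (u @ [k] @ w @ [l] @ v) = r \<Longrightarrow> sqs (u @ [k] @ w @ [l] @ v) = s \<Longrightarrow> \<bar>k - l\<bar> \<ge> 2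
    \<Longrightarrow> word h (u @ [k] @ w @ [l] @ v) \<in> pos_span h B"
proof (induction w arbitrary: u)
  case Nil
  then show ?case using word_adjacent_gap[where u = u and k = k and l = l and v = v, OF h B short small] by simp
next
  case (Cons x w)
  show ?case
  proof (cases "\<bar>k - x\<bar> \<le> 1")
    case True
    then obtain c where c: "var h k * var h x = scl (qh c) (var h x * var h k)"
      using near_commute by blast
    have "word h ((u @ [x]) @ [k] @ w @ [l] @ v) \<in> pos_span h B"
      by (rule Cons.IH) (use Cons.prems in auto)
    moreover have "word h (u @ [k] @ (x # w) @ [l] @ v) = scl (qh c) (word h ((u @ [x]) @ [k] @ w @ [l] @ v))"
      using arg_cong[OF c, of "\<lambda>z. word h u * z * word h (w @ [l] @ v)"]
      by (simp add: mult.assoc scl_mult)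
    ultimately show ?thesis by (simp only: pos_span_scl nonneg_poly_qh)
  next
    case False
    then show ?thesis
      using word_adjacent_gap[where u = u and k = k and l = x and v = "w @ [l] @ v", OF h B short small] Cons.prems by simp
  qed
qed

lemma gap_or_near:
  fixes ks :: "int list"
  obtains u k w l v where "ks = u @ [k] @ w @ [l] @ v" "\<bar>k - l\<bar> \<ge> 2"
  | m where "set ks \<subseteq> {m, m + 1}"
proof (cases "\<exists>k\<in>set ks. \<exists>l\<in>set ks. \<bar>k - l\<bar> \<ge> 2")
  case True
  then obtain k l where kl: "k \<in> set ks" "l \<in> set ks" "\<bar>k - l\<bar> \<ge> 2" by blast
  obtain u t where ks: "ks = u @ k # t" using kl(1) by (meson split_list)
  have "l \<in> set u \<or> l \<in> set t" using kl ks by auto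
  then show ?thesis
  proof
    assume "l \<in> set t"
    then obtain w v where "t = w @ l # v" by (meson split_list)
    then show ?thesis using that(1)[of u k w l v] ks kl(3) by simp
  next
    assume "l \<in> set u"
    then obtain u' w where "u = u' @ l # w" by (meson split_list)
    then show ?thesis using that(1)[of u' l w k t] ks kl(3) by (simp add: abs_minus_commute)
  qed
next
  case False
  show ?thesis
  proof (cases "ks = []")
    case True
    then show ?thesis using that(2)[of 0] by simp
  next
    case ne: False
    have "set ks \<subseteq> {Min (set ks), Min (set ks) + 1}"
    proof
      fix k assume k: "k \<in> set ks"
      have "Min (set ks) \<le> k" "Min (set ks) \<in> set ks" using k ne by auto
      moreover from this False k have "\<not> \<bar>k - Min (set ks)\<bar> \<ge> 2" by blast
      ultimately show "k \<in> {Min (set ks), Min (set ks) + 1}" by (simp, linarith)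
    qed
    then show ?thesis by (rule that(2))
  qed
qed

lemma var_power_commute:
  "var h (m + 1) * var h m ^ a = scl (qh (- 2 * int a)) (var h m ^ a * var h (m + 1))"
proof (induction a)
  case (Suc a)
  have "var h (m + 1) * var h m = scl (qh (-2)) (var h m * var h (m + 1))"
    by (simp add: var_commute[of h m] qh_mult)
  then have "var h (m + 1) * var h m ^ Suc a = scl (qh (-2)) (var h m * (var h (m + 1) * var h m ^ a))"
    by (metis mult.assoc power_Suc scl_mult(1))
  then show ?case
    by (simp add: Suc scl_mult qh_mult mult.assoc)
qed simp

lemma word_near:
  "set ks \<subseteq> {m, m + 1} \<Longrightarrow> \<exists>c a b. word h ks = scl (qh c) (var h m ^ a * var h (m + 1) ^ b)"
proof (induction ks)
  case Nil
  show ?case by (rule exI[of _ 0], rule exI[of _ 0], rule exI[of _ 0]) simp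
next
  case (Cons k ks)
  then obtain c a b where w: "word h ks = scl (qh c) (var h m ^ a * var h (m + 1) ^ b)" by auto
  show ?case
  proof (cases "k = m")
    case True
    then show ?thesis
      by (intro exI[of _ c] exI[of _ "Suc a"] exI[of _ b]) (simp add: w scl_mult mult.assoc)
  next
    case False
    then have k: "k = m + 1" using Cons.prems by auto
    have "var h (m + 1) * (var h m ^ a * var h (m + 1) ^ b)
      = scl (qh (- 2 * int a)) (var h m ^ a * var h (m + 1) ^ Suc b)"
      by (simp add: var_power_commute scl_mult flip: mult.assoc)
    then show ?thesis
      by (intro exI[of _ "c - 2 * int a"] exI[of _ a] exI[of _ "Suc b"]) (simp add: w k scl_mult qh_mult)
  qed
qed

text \<open>The outer induction on length absorbs the remainders of \<open>word_reduce\<close>, the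
  inner one on \<open>sqs\<close> its leading term. Words without a gap are scaled monomials by
  \<open>word_near\<close>.\<close>

lemma word_in:
  assumes h: "bar h = h" and B: "cheb_gens h \<subseteq> B"
    and mono: "\<And>m a b. var h m ^ a * var h (m + 1) ^ b \<in> pos_span h B"
  shows "word h ks \<in> pos_span h B"
proof (induction "length ks" arbitrary: ks rule: less_induct)
  case less
  note short = this
  define r where "r = length ks"
  have "length ks = r \<Longrightarrow> word h ks \<in> pos_span h B" for ks
  proof (induction "nat (sqs ks)" arbitrary: ks rule: less_induct)
    case less
    show ?case
    proof (cases ks rule: gap_or_near)
      case (1 u k w l v)
      show ?thesis
        unfolding 1(1)
      proof (rule word_gap[OF h B _ _ _ refl 1(2)])
        show "length (u @ [k] @ w @ [l] @ v) = r" using 1(1) less.prems by simp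
        show "word h ks' \<in> pos_span h B" if "length ks' < r" for ks'
          using short that by (simp add: r_def)
        show "word h ks' \<in> pos_span h B" if "length ks' = r" "sqs ks' < sqs (u @ [k] @ w @ [l] @ v)" for ks'
          using less.hyps[of ks'] that sqs_nonneg[of ks'] unfolding 1(1) by linarith
      qed
    next
      case (2 m)
      then show ?thesis using word_near[of ks m h] mono by (metis nonneg_poly_qh pos_span_scl)
    qed
  qed
  then show ?case by (simp add: r_def)
qed

subsection \<open>The basis\<close>

definition monomial :: "laurent \<Rightarrow> int \<Rightarrow> nat \<Rightarrow> nat \<Rightarrow> qtorus" where
  "monomial h m a b = scl (qh (- int (a * b))) (var h m ^ a * var h (m + 1) ^ b)"

lemma cluster_monomials_eq:
  "bar h = h \<Longrightarrow> cluster_monomials h = {monomial h m a b | m a b. True}"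
  by (simp add: cluster_monomials_def monomial_def cluster_var_eq)

lemma Xdelta_eq: "bar h = h \<Longrightarrow> Xdelta h = delta_elt h"
  by (simp add: Xdelta_def cluster_var_eq flip: delta_elt_eq)

lemma delta_elements_eq: "bar h = h \<Longrightarrow> delta_elements h = {chebT n (delta_elt h) | n. n > 0}"
  by (auto simp: delta_elements_def Xdelta_eq cheb_eq_chebT) (metis cheb_eq_chebT)

lemma basis_cases:
  assumes "bar h = h" "b \<in> basis_B h"
  obtains m a c where "b = monomial h m a c" | n where "n > 0" "b = chebT n (delta_elt h)"
  using assms by (auto simp: basis_B_def cluster_monomials_eq delta_elements_eq)

lemma monomial_in_basis: "bar h = h \<Longrightarrow> monomial h m a b \<in> basis_B h"
  by (auto simp: basis_B_def cluster_monomials_eq)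

lemma chebT_in_basis: "bar h = h \<Longrightarrow> n > 0 \<Longrightarrow> chebT n (delta_elt h) \<in> basis_B h"
  by (auto simp: basis_B_def delta_elements_eq)

lemma cheb_gens_subset: "bar h = h \<Longrightarrow> cheb_gens h \<subseteq> basis_B h"
  using monomial_in_basis[of h 0 0 0] chebT_in_basis[of h] by (auto simp: cheb_gens_def monomial_def)

lemma monomial_word: "monomial h m a b = scl (qh (- int (a * b))) (word h (replicate a m @ replicate b (m + 1)))"
  by (simp add: monomial_def word_def prod_list_replicate)

lemma word_in_basis_span:
  assumes h: "bar h = h"
  shows "word h ks \<in> pos_span h (basis_B h)"
proof (rule word_in[OF h cheb_gens_subset[OF h]])
  fix m a b
  have "var h m ^ a * var h (m + 1) ^ b = scl (qh (int (a * b))) (monomial h m a b)"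
    by (simp add: monomial_def qh_mult)
  then show "var h m ^ a * var h (m + 1) ^ b \<in> pos_span h (basis_B h)"
    using monomial_in_basis[OF h] by (simp only: pos_span_scl pos_span_base nonneg_poly_qh)
qed

lemma word_cheb_word_in:
  assumes h: "bar h = h"
  shows "word h u * chebT n (delta_elt h) * word h v \<in> pos_span h (basis_B h)"
proof (rule sandwich)
  show "chebT n (delta_elt h) \<in> pos_span h (gens h)" by (rule chebT_in) simp
  show "word h u * g * word h v \<in> pos_span h (basis_B h)" if "g \<in> cheb_gens h" for g
    by (rule word_cheb_word[OF h cheb_gens_subset[OF h] word_in_basis_span[OF h] lessI that])
qed (rule word_in_basis_span[OF h])

text \<open>Monomials are scaled words, so a product involving one is a word, possibly with a
  Chebyshev element inside. Two Chebyshev elements multiply by the product-to-sum rule.\<close>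

lemma basis_mult:
  assumes h: "bar h = h" and b: "b \<in> basis_B h" and b': "b' \<in> basis_B h"
  shows "b * b' \<in> pos_span h (basis_B h)"
  using h b
proof (cases rule: basis_cases)
  case b: (1 m a c)
  show ?thesis using h b'
  proof (cases rule: basis_cases)
    case b': (1 m' a' c')
    show ?thesis
      using word_in_basis_span[OF h, of "(replicate a m @ replicate c (m + 1)) @ (replicate a' m' @ replicate c' (m' + 1))"]
      unfolding b b' monomial_word word_simps(3)[symmetric] scl_mult
      by (intro pos_span_scl nonneg_poly_qh) (simp add: mult.assoc)
  next
    case b': (2 n)
    show ?thesis
      using word_cheb_word_in[OF h, of "replicate a m @ replicate c (m + 1)" n "[]"]
      unfolding b b' monomial_word scl_mult by (intro pos_span_scl nonneg_poly_qh) simp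
  qed
next
  case b: (2 n)
  show ?thesis using h b'
  proof (cases rule: basis_cases)
    case b': (1 m' a' c')
    show ?thesis
      using word_cheb_word_in[OF h, of "[]" n "replicate a' m' @ replicate c' (m' + 1)"]
      unfolding b b' monomial_word scl_mult by (intro pos_span_scl nonneg_poly_qh) simp
  next
    case b': (2 n')
    have T: "chebT n (delta_elt h) * chebT n' (delta_elt h) \<in> pos_span h (basis_B h)" if "n' \<le> n" for n n'
      unfolding chebT_mult[OF that] using cheb_gens_subset[OF h] by (intro pos_span_add chebT_in)
    have "chebT n (delta_elt h) * chebT n' (delta_elt h) = chebT n' (delta_elt h) * chebT n (delta_elt h)"
      by (rule chebT_commute) (rule chebT_one_commute)
    then show ?thesis unfolding b b' using T by (metis nat_le_linear)
  qed
qed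

lemma tbar_power: "tbar (x ^ n) = tbar x ^ n"
  by (induction n) (simp_all add: tbar_mult power_commutes)

lemma var_power_power_commute:
  "var h (m + 1) ^ b * var h m ^ a = scl (qh (- 2 * int (a * b))) (var h m ^ a * var h (m + 1) ^ b)"
proof (induction b)
  case (Suc b)
  have e: "- 2 * int (a * b) + - 2 * int a = - 2 * int (a * Suc b)" by (simp add: algebra_simps)
  have "var h (m + 1) ^ Suc b * var h m ^ a = var h (m + 1) * (var h (m + 1) ^ b * var h m ^ a)"
    by (simp add: mult.assoc)
  also have "\<dots> = scl (qh (- 2 * int (a * b))) ((var h (m + 1) * var h m ^ a) * var h (m + 1) ^ b)"
    by (simp add: Suc scl_mult mult.assoc)
  also have "\<dots> = scl (qh (- 2 * int (a * Suc b))) (var h m ^ a * var h (m + 1) ^ Suc b)"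
    by (simp only: var_power_commute scl_mult qt.scale_scale qh_mult e mult.assoc power_Suc)
  finally show ?case .
qed simp

text \<open>Bar reverses the two powers; restoring their order costs \<open>q^{-ac}\<close>, which
  turns \<open>q^{ac/2}\<close> back into the normalising \<open>q^{-ac/2}\<close>.\<close>

lemma tbar_basis:
  assumes h: "bar h = h" and b: "b \<in> basis_B h"
  shows "tbar b = b"
  using h b
proof (cases rule: basis_cases)
  case (1 m a c)
  show ?thesis
    unfolding 1 monomial_def tbar_scl tbar_mult tbar_power tbar_var[OF h] var_power_power_commute
    by (simp add: qh_mult)
next
  case (2 n)
  then show ?thesis by (simp add: tbar_chebT tbar_delta h)
qed

section \<open>Lowest exponents of the basis elements\<close>

lemma lowest_monomial:
  "lowest (int a * fst (low m) + int b * fst (low (m + 1)), int a * snd (low m) + int b * snd (low (m + 1)))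
     (monomial h m a b)"
  using lowest_scl[OF lowest_mult[OF lowest_power[OF lowest_var] lowest_power[OF lowest_var]], where r = "- int (a * b)"]
  by (simp add: monomial_def)

lemma lowest_chebT: "n > 0 \<Longrightarrow> lowest (- int n, - int n) (chebT n (delta_elt h))"
proof (induction n rule: induct_nat_012)
  case 1
  then show ?case by (simp add: lowest_delta)
next
  case (ge2 n)
  have "above (- int n, - int n) (chebT n (delta_elt h))"
  \<comment> \<open>At index 0 the element is 2, whose coefficient is not a power of
    \<open>q^{1/2}\<close>, so only the bound \<open>above\<close> holds.\<close>
  proof (cases "n = 0")
    case True
    have "above (0, 0) (1 + 1)" by (intro above_add lowest_above lowest_one)
    then show ?thesis by (simp add: True)
  qed (use ge2 lowest_above in auto)
  then have "lowest (- int (Suc n) - 1, - int (Suc n) - 1) (chebT (Suc n) (delta_elt h) * delta_elt h - chebT n (delta_elt h))"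
    using lowest_mult[OF ge2.IH(2) lowest_delta[of h]] by (intro lowest_add_above(2)) auto
  moreover have "- int (Suc n) - 1 = - int (Suc (Suc n))" by simp
  ultimately show ?case by (simp only: chebT_Suc_Suc)
qed simp

text \<open>Inverts the map sending a basis element to its lowest exponent: \<^term>\<open>low m\<close> and
  \<^term>\<open>low (m + 1)\<close> span the cones of the cluster fan, whose complement is the open ray through
  (-1, -1).\<close>

definition basis_elt :: "laurent \<Rightarrow> int \<times> int \<Rightarrow> qtorus" where
  "basis_elt h p = (case p of (x, y) \<Rightarrow>
     if x \<ge> 0 \<and> y \<ge> 0 then monomial h 1 (nat x) (nat y)
     else if x = y then chebT (nat (- x)) (delta_elt h)
     else if x < y then monomial h ((- x) div (y - x) + 2) (nat (y - x - (- x) mod (y - x))) (nat ((- x) mod (y - x)))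
     else monomial h (- ((- y) div (x - y))) (nat ((- y) mod (x - y))) (nat (x - y - (- y) mod (x - y))))"

lemma monomial_0: "monomial h m a 0 = var h m ^ a" "monomial h m 0 b = var h (m + 1) ^ b"
  by (simp_all add: monomial_def)

lemma div_mod_unique:
  fixes k :: int
  assumes "z = k * n + r" "0 \<le> r" "r < n"
  shows "z div n = k" "z mod n = r"
  using assms by (simp_all add: div_mult_self3 mod_mult_self3)

text \<open>Since \<open>y - x = a + b\<close>, dividing \<open>- x\<close> by it recovers
  \<open>m - 2\<close> and \<open>b\<close> as long as \<open>b < a + b\<close>.\<close>

lemma basis_elt_monomial_up:
  assumes m: "m \<ge> 2" and x: "x = - ((m - 2) * (int a + int b) + int b)" and y: "y = x + int a + int b"
    and ab: "a + b > 0"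
  shows "basis_elt h (x, y) = monomial h m a b"
proof -
  have "0 \<le> (m - 2) * (int a + int b)" using m by simp
  have d: "y - x = int a + int b" using x y by simp
  \<comment> \<open>At \<open>x = 0\<close> the element is a power of \<open>X_2\<close> and falls
    into the quadrant branch. For \<open>a = 0\<close> the quotient rises by 1 with remainder 0, and
    \<open>X_{m+1}^b\<close> is described with index \<open>m + 1\<close>.\<close>
  consider "x = 0" | "x < 0" "a > 0" | "x < 0" "a = 0" using x m \<open>0 \<le> _\<close> by linarith
  then show ?thesis
  proof cases
    case 1
    then have "b = 0" "(m - 2) * (int a + int b) = 0" using x \<open>0 \<le> _\<close> by linarith+
    then have "b = 0" "m = 2" using ab by auto
    then show ?thesis using 1 y by (simp add: basis_elt_def monomial_0)
  next
    case 2
    have "- x = (m - 2) * (y - x) + int b" "0 \<le> int b" "int b < y - x"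
      unfolding d using x y 2 by (simp_all add: algebra_simps)
    from div_mod_unique[OF this]
    show ?thesis using 2 y by (simp add: basis_elt_def)
  next
    case 3
    have "- x = (m - 1) * (y - x) + 0" "0 \<le> (0::int)" "0 < y - x"
      unfolding d using x y 3 ab by (simp_all add: algebra_simps)
    from div_mod_unique[OF this]
    show ?thesis using 3 y ab by (simp add: basis_elt_def monomial_0 add.commute)
  qed
qed

text \<open>The same division with the coordinates exchanged, recovering \<open>- m\<close> and
  \<open>a\<close>; here \<open>b = 0\<close> is the borderline case.\<close>

lemma basis_elt_monomial_down:
  assumes m: "m \<le> 0" and y: "y = - ((- m) * (int a + int b) + int a)" and x: "x = y + int a + int b"
    and ab: "a + b > 0"
  shows "basis_elt h (x, y) = monomial h m a b"
proof -
  have nn: "0 \<le> (- m) * (int a + int b)" using m by (intro mult_nonneg_nonneg) auto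
  have d: "x - y = int a + int b" using x y by simp
  consider "y = 0" | "y < 0" "b > 0" | "y < 0" "b = 0" using y m nn by linarith
  then show ?thesis
  proof cases
    case 1
    then have "a = 0" "(- m) * (int a + int b) = 0" using y nn by linarith+
    then have "a = 0" "m = 0" using ab by auto
    then show ?thesis using 1 x by (simp add: basis_elt_def monomial_0)
  next
    case 2
    have "- y = (- m) * (x - y) + int a" "0 \<le> int a" "int a < x - y"
      unfolding d using x y 2 by (simp_all add: algebra_simps)
    from div_mod_unique[OF this]
    show ?thesis using 2 x by (simp add: basis_elt_def)
  next
    case 3
    have "- y = (1 - m) * (x - y) + 0" "0 \<le> (0::int)" "0 < x - y"
      unfolding d using x y 3 ab by (simp_all add: algebra_simps)
    from div_mod_unique[OF this]
    show ?thesis using 3 x ab by (simp add: basis_elt_def monomial_0)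
  qed
qed

text \<open>The second claim keeps monomials off the open ray of the Chebyshev elements and yields
  \<open>basis_disjoint\<close>.\<close>

lemma basis_elt_monomial:
  assumes "lowest p (monomial h m a b)"
  shows "basis_elt h p = monomial h m a b" "fst p = snd p \<Longrightarrow> fst p \<ge> 0"
proof -
  obtain x y where p: "p = (x, y)" by fastforce
  have xy: "x = int a * fst (low m) + int b * fst (low (m + 1))"
    "y = int a * snd (low m) + int b * snd (low (m + 1))"
    using lowest_unique[OF assms lowest_monomial] p by auto
  have "basis_elt h (x, y) = monomial h m a b \<and> (x = y \<longrightarrow> x \<ge> 0)"
  proof (cases "a + b = 0 \<or> m = 1")
    case True
    then show ?thesis using xy by (auto simp: basis_elt_def monomial_0 low_def)
  next
    case False
    then consider "m \<ge> 2" | "m \<le> 0" by linarith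
    then show ?thesis
    proof cases
      case 1
      have "y = x + int a + int b" "x = - ((m - 2) * (int a + int b) + int b)"
        using xy 1 by (simp_all add: low_def algebra_simps)
      then show ?thesis using basis_elt_monomial_up[OF 1] False by auto
    next
      case 2
      have "x = y + int a + int b" "y = - ((- m) * (int a + int b) + int a)"
        using xy 2 by (simp_all add: low_def algebra_simps)
      then show ?thesis using basis_elt_monomial_down[OF 2] False by auto
    qed
  qed
  then show "basis_elt h p = monomial h m a b" "fst p = snd p \<Longrightarrow> fst p \<ge> 0"
    by (simp_all add: p)
qed

lemma basis_elt_chebT:
  assumes "lowest p (chebT n (delta_elt h))" "n > 0"
  shows "basis_elt h p = chebT n (delta_elt h)"
  using lowest_unique[OF assms(1) lowest_chebT[OF assms(2)]] assms(2) by (simp add: basis_elt_def)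

text \<open>\<open>basis_elt\<close> recovers an element from its lowest exponent, so distinct
  elements have distinct exponents.\<close>

lemma basis_independent:
  assumes h: "bar h = h"
  shows "qt.independent (basis_B h)"
proof (rule independent_lowest)
  show "\<exists>p. lowest p b" if "b \<in> basis_B h" for b
    using h that by (cases rule: basis_cases) (blast intro: lowest_monomial lowest_chebT)+
  have "basis_elt h p = b" if "b \<in> basis_B h" "lowest p b" for b p
    using h that(1) by (cases rule: basis_cases) (use that(2) basis_elt_monomial(1) basis_elt_chebT in blast)+
  then show "b = b'" if "b \<in> basis_B h" "b' \<in> basis_B h" "lowest p b" "lowest p b'" for b b' p
    using that by metis
qed

lemma basis_disjoint:
  assumes h: "bar h = h"
  shows "cluster_monomials h \<inter> delta_elements h = {}"
proof -
  have False if "monomial h m a b = chebT n (delta_elt h)" "n > 0" for m a b n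
    using basis_elt_monomial(2)[of "(- int n, - int n)" h m a b] lowest_chebT[of n h] that by simp
  then show ?thesis by (auto simp: cluster_monomials_eq[OF h] delta_elements_eq[OF h])
qed

text \<open>The span contains 1 and all cluster variables and is closed under products by
  \<open>basis_mult\<close>. Conversely, basis elements arise from cluster variables by algebra
  operations.\<close>

lemma basis_span:
  assumes h: "bar h = h"
  shows "Xdelta h \<in> Aq h" "qt.span (basis_B h) = Aq h"
proof -
  have sub: "subalgebra (Aq h)"
    unfolding Aq_def by (rule hull_in) (auto simp: subalgebra_def intro!: qt.subspace_Inter)
  have s: "x \<in> Aq h \<Longrightarrow> y \<in> Aq h \<Longrightarrow> x + y \<in> Aq h" "x \<in> Aq h \<Longrightarrow> y \<in> Aq h \<Longrightarrow> x - y \<in> Aq h"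
    "x \<in> Aq h \<Longrightarrow> scl c x \<in> Aq h" "x \<in> Aq h \<Longrightarrow> y \<in> Aq h \<Longrightarrow> x * y \<in> Aq h" for x y c
    using sub by (auto simp: subalgebra_def qt.subspace_add qt.subspace_diff qt.subspace_scale)
  have 1: "1 \<in> Aq h" using sub by (simp add: subalgebra_def)
  have v: "var h k \<in> Aq h" for k
    using hull_subset[of "range (var h)" subalgebra] by (auto simp: Aq_def cluster_var_eq[OF h])
  show d: "Xdelta h \<in> Aq h"
    unfolding Xdelta_def cluster_var_eq[OF h] by (intro s v 1)
  have pow: "x ^ n \<in> Aq h" if "x \<in> Aq h" for x n
    by (induction n) (auto intro: s 1 that)
  have "1 + 1 \<in> Aq h" by (intro s 1)
  then have T: "chebT n (delta_elt h) \<in> Aq h" for n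
    by (induction n rule: induct_nat_012) (use d in \<open>auto simp: chebT_Suc_Suc Xdelta_eq[OF h] intro: s\<close>)
  have B: "b \<in> Aq h" if "b \<in> basis_B h" for b
    using h that by (cases rule: basis_cases) (auto simp: monomial_def intro: s pow v T)
  show "qt.span (basis_B h) = Aq h"
  proof
    show "qt.span (basis_B h) \<subseteq> Aq h"
      using B sub by (intro qt.span_minimal) (auto simp: subalgebra_def)
    have var: "var h k \<in> qt.span (basis_B h)" for k
      using monomial_in_basis[OF h, of k 1 0] by (auto simp: monomial_def intro: qt.span_base)
    have one: "1 \<in> qt.span (basis_B h)"
      using monomial_in_basis[OF h, of 0 0 0] by (auto simp: monomial_def intro: qt.span_base)
    \<comment> \<open>Closure under products is extended linearly in one factor at a time, first the
      right one.\<close>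
    have left: "b * y \<in> qt.span (basis_B h)" if b: "b \<in> basis_B h" and y: "y \<in> qt.span (basis_B h)" for b y
      using y
    proof (induction rule: qt.span_induct_alt)
      case (step c b' y)
      then show ?case
        using pos_span_span[OF basis_mult[OF h b]]
        by (auto simp: distrib_left scl_mult intro: qt.span_add qt.span_scale)
    qed (simp add: qt.span_zero)
    have mult: "x * y \<in> qt.span (basis_B h)" if x: "x \<in> qt.span (basis_B h)" and y: "y \<in> qt.span (basis_B h)" for x y
      using x
    proof (induction rule: qt.span_induct_alt)
      case (step c b x)
      then show ?case
        using left[OF _ y] by (auto simp: distrib_right scl_mult intro: qt.span_add qt.span_scale)
    qed (simp add: qt.span_zero)
    show "Aq h \<subseteq> qt.span (basis_B h)"
      unfolding Aq_def cluster_var_eq[OF h]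
      by (rule hull_minimal) (auto simp: subalgebra_def var one mult)
  qed
qed

theorem theorem4p4:
  fixes h :: laurent
  assumes "bar h = h"
  shows "Xdelta h \<in> Aq h
    \<and> cluster_monomials h \<inter> delta_elements h = {}
    \<and> qt.independent (basis_B h) \<and> qt.span (basis_B h) = Aq h
    \<and> (\<forall>b\<in>basis_B h. tbar b = b)
    \<and> (\<forall>b\<in>basis_B h. \<forall>b'\<in>basis_B h. \<exists>S c.
          finite S \<and> S \<subseteq> basis_B h \<and> (\<forall>x\<in>S. c x \<in> nonneg_poly h) \<and>
          b * b' = (\<Sum>x\<in>S. scl (c x) x))"
  using basis_span[OF assms] basis_disjoint[OF assms] basis_independent[OF assms] tbar_basis[OF assms]
    pos_span_explicit[OF basis_mult[OF assms]]
  by simp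

end
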